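(* Let $(E,\mathcal{P})$ be a random locally convex module over $K$ with base $(\Omega,\mathcal{F},P)$ such that $\mathcal{P}$ has the countable concatenation property, $M$ a $\mathcal{T}_c$-closed subset of $E$ with the countable concatenation property, and $x\in E$ such that $\tilde I_A\{x\}\cap\tilde I_AM=\emptyset$ for all $A\in\mathcal{F}$ with $P(A)>0$. Then there is an $L^0$-convex, $L^0$-absorbent and $L^0$-balanced $\mathcal{T}_c$-neighborhood $U$ of $\theta$ such that $$\tilde I_A(x+U)\cap\tilde I_A(M+U)=\emptyset$$ for all $A\in\mathcal{F}$ with $P(A)>0$.
   Context: $(\Omega,\mathcal{F},P)$ is a probability space and $K$ is $\mathbb{R}$ or $\mathbb{C}$. $L^0(\mathcal{F},K)$ is the algebra of equivalence classes (a.s. equality) of $K$-valued $\mathcal{F}$-measurable random variables, $L^0(\mathcal{F})=L^0(\mathcal{F},\mathbb{R})$ with the a.s. order; $L^0_+(\mathcal{F})=\{\xi\in L^0(\mathcal{F}):\xi\ge0\}$, $L^0_{++}(\mathcal{F})=\{\xi\in L^0(\mathcal{F}):\xi>0\text{ a.s.}\}$; $\tilde I_A$ is the class of the indicator of $A\in\mathcal{F}$, and $\tilde I_AG=\{\tilde I_Ag:g\in G\}$ for $G\subset E$. A countable partition $\{A_n,n\in\mathbb{N}\}$ of $\Omega$ to $\mathcal{F}$ is a sequence of pairwise disjoint members of $\mathcal{F}$ with union $\Omega$. Random locally convex module over $K$ with base $(\Omega,\mathcal{F},P)$: a pair $(E,\mathcal{P})$ with $E$ an $L^0(\mathcal{F},K)$-module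 and $\mathcal{P}$ a family of $L^0$-seminorms on $E$ (maps $\|\cdot\|:E\to L^0_+(\mathcal{F})$ with $\|\xi x\|=|\xi|\|x\|$ for $\xi\in L^0(\mathcal{F},K)$ and $\|x+y\|\le\|x\|+\|y\|$) such that $\bigvee\{\|x\|:\|\cdot\|\in\mathcal{P}\}=0$ iff $x=\theta$ (null element). $\mathcal{P}_f$ is the family of (nonempty) finite subsets of $\mathcal{P}$, and $\|x\|_{\mathcal{Q}}=\bigvee\{\|x\|:\|\cdot\|\in\mathcal{Q}\}$ for $\mathcal{Q}\in\mathcal{P}_f$. $\mathcal{P}$ has the countable concatenation property if $\mathcal{P}_{cc}=\mathcal{P}$, where $\mathcal{P}_{cc}=\{\sum_{n=1}^\infty\tilde I_{A_n}\|\cdot\|_{\mathcal{Q}_n}: \{A_n\}$ a countable partition of $\Omega$ to $\mathcal{F}$, $\{\mathcal{Q}_n\}$ a sequence in $\mathcal{P}_f\}$. The locally $L^0$-convex topology $\mathcal{T}_c$ on $E$ has local base at $\theta$: $\{x:\|x\|_{\mathcal{Q}}\le\varepsilon\}$, $\mathcal{Q}\in\mathcal{P}_f$, $\varepsilon\in L^0_{++}(\mathcal{F})$. A subset $B\subset E$ is: $L^0$-convex if $\xi x+(1-\xi)y\in B$ for all $x,y\in B$, $\xi\in L^0_+(\mathcal{F})$, $0\le\xi\le1$; $L^0$-balanced if $\eta B\subset B$ for all $\eta\in L^0(\mathcal{F},K)$ with $|\eta|\le1$; $L^0$-absorbent if for each $x\in E$ there is $\xi\in L^0_{++}(\mathcal{F})$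 with $\eta x\in B$ for all $\eta\in L^0(\mathcal{F},K)$ with $|\eta|\le\xi$. $B$ has the countable concatenation property if for each sequence $\{x_n\}$ in $B$ and each countable partition $\{A_n\}$ of $\Omega$ to $\mathcal{F}$ there is $x\in B$ with $\tilde I_{A_n}x=\tilde I_{A_n}x_n$ for all $n$. *)

theory Defs
  imports "HOL-Probability.Probability" "HOL-Algebra.AbelCoset" "HOL-Algebra.Module"
begin

text \<open>
  The scalar field \<open>K\<close>, being \<open>\<real>\<close> or \<open>\<complex>\<close>, is rendered by the sort
  \<open>{real_normed_field, euclidean_space}\<close>: by the theorem of Frobenius its instances are, up to
  isometric isomorphism, exactly the types \<^typ>\<open>real\<close> and \<^typ>\<open>complex\<close>.

  An element of \<open>L\<^sup>0(\<F>,K)\<close> is a set of functions, namely a full class of measurable functions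
  modulo almost sure equality. The probability space \<open>(\<Omega>,\<F>,P)\<close> is the measure \<open>M\<close>.
\<close>

definition L0_class :: "'w measure \<Rightarrow> ('w \<Rightarrow> 'k) \<Rightarrow> ('w \<Rightarrow> 'k::topological_space) set" where
  "L0_class M f = {g \<in> borel_measurable M. AE w in M. g w = f w}"

definition L0_rep :: "('w \<Rightarrow> 'k) set \<Rightarrow> 'w \<Rightarrow> 'k" where
  "L0_rep a = (SOME f. f \<in> a)"

definition L0 :: "'w measure \<Rightarrow> ('w \<Rightarrow> 'k::real_normed_field) set ring" where
  "L0 M = \<lparr>carrier = L0_class M ` borel_measurable M,
           mult = (\<lambda>a b. L0_class M (\<lambda>w. L0_rep a w * L0_rep b w)),
           one = L0_class M (\<lambda>w. 1),
           zero = L0_class M (\<lambda>w. 0),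
           add = (\<lambda>a b. L0_class M (\<lambda>w. L0_rep a w + L0_rep b w))\<rparr>"

definition L0_indicator :: "'w measure \<Rightarrow> 'w set \<Rightarrow> ('w \<Rightarrow> 'k::real_normed_field) set" where
  "L0_indicator M A = L0_class M (indicator A)"

definition L0_abs :: "'w measure \<Rightarrow> ('w \<Rightarrow> 'k::real_normed_field) set \<Rightarrow> ('w \<Rightarrow> real) set" where
  "L0_abs M a = L0_class M (\<lambda>w. norm (L0_rep a w))"

definition L0_of_real :: "'w measure \<Rightarrow> ('w \<Rightarrow> real) set \<Rightarrow> ('w \<Rightarrow> 'k::real_normed_field) set" where
  "L0_of_real M a = L0_class M (\<lambda>w. of_real (L0_rep a w))"

definition L0_le :: "'w measure \<Rightarrow> ('w \<Rightarrow> real) set \<Rightarrow> ('w \<Rightarrow> real) set \<Rightarrow> bool" where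
  "L0_le M a b \<longleftrightarrow> (AE w in M. L0_rep a w \<le> L0_rep b w)"

definition L0_nonneg :: "'w measure \<Rightarrow> ('w \<Rightarrow> real) set set" where
  "L0_nonneg M = {a \<in> carrier (L0 M). L0_le M \<zero>\<^bsub>L0 M\<^esub> a}"

definition L0_pos :: "'w measure \<Rightarrow> ('w \<Rightarrow> real) set set" where
  "L0_pos M = {a \<in> carrier (L0 M). AE w in M. 0 < L0_rep a w}"

text \<open>
  Suprema are least upper bounds for the almost sure order. For a nonempty family in
  \<open>L\<^sup>0(\<F>)\<close>, being the supremum \<open>s \<in> L\<^sup>0(\<F>)\<close> means the same whether upper bounds range over
  \<open>L\<^sup>0(\<F>)\<close> or also over classes of extended real random variables (replace such an upper bound
  by its minimum with \<open>s\<close>).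
\<close>

definition L0_is_Sup :: "'w measure \<Rightarrow> ('w \<Rightarrow> real) set set \<Rightarrow> ('w \<Rightarrow> real) set \<Rightarrow> bool" where
  "L0_is_Sup M S s \<longleftrightarrow> s \<in> carrier (L0 M) \<and> (\<forall>a\<in>S. L0_le M a s) \<and>
     (\<forall>u\<in>carrier (L0 M). (\<forall>a\<in>S. L0_le M a u) \<longrightarrow> L0_le M s u)"

definition L0_Sup :: "'w measure \<Rightarrow> ('w \<Rightarrow> real) set set \<Rightarrow> ('w \<Rightarrow> real) set" where
  "L0_Sup M S = (THE s. L0_is_Sup M S s)"

text \<open>The sum is taken pointwise almost surely; it is used only for disjointly supported terms.\<close>

definition L0_suminf :: "'w measure \<Rightarrow> (nat \<Rightarrow> ('w \<Rightarrow> real) set) \<Rightarrow> ('w \<Rightarrow> real) set" where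
  "L0_suminf M a = L0_class M (\<lambda>w. \<Sum>n. L0_rep (a n) w)"

definition countable_partition :: "'w measure \<Rightarrow> (nat \<Rightarrow> 'w set) \<Rightarrow> bool" where
  "countable_partition M A \<longleftrightarrow>
     range A \<subseteq> sets M \<and> disjoint_family A \<and> (\<Union>n. A n) = space M"

lemma L0_simps:
  "carrier (L0 M) = L0_class M ` borel_measurable M"
  "a \<otimes>\<^bsub>L0 M\<^esub> b = L0_class M (\<lambda>w. L0_rep a w * L0_rep b w)"
  "a \<oplus>\<^bsub>L0 M\<^esub> b = L0_class M (\<lambda>w. L0_rep a w + L0_rep b w)"
  "\<one>\<^bsub>L0 M\<^esub> = L0_class M (\<lambda>w. 1)"
  "\<zero>\<^bsub>L0 M\<^esub> = L0_class M (\<lambda>w. 0)"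
  by (simp_all add: L0_def)

lemma L0_rep_class:
  assumes "f \<in> borel_measurable M"
  shows "L0_rep (L0_class M f) \<in> borel_measurable M" "AE w in M. L0_rep (L0_class M f) w = f w"
proof -
  have "f \<in> L0_class M f"
    using assms by (simp add: L0_class_def)
  then have "L0_rep (L0_class M f) \<in> L0_class M f"
    unfolding L0_rep_def by (rule someI[of "\<lambda>h. h \<in> L0_class M f"])
  then show "L0_rep (L0_class M f) \<in> borel_measurable M"
    "AE w in M. L0_rep (L0_class M f) w = f w"
    by (simp_all add: L0_class_def)
qed

lemma L0_class_cong:
  assumes "AE w in M. f w = g w"
  shows "L0_class M f = L0_class M g"
proof -
  have "(AE w in M. h w = f w) \<longleftrightarrow> (AE w in M. h w = g w)" for h
    using assms by (auto elim: AE_mp)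
  then show ?thesis
    by (simp add: L0_class_def)
qed

lemma L0_rep_measurable:
  assumes "a \<in> carrier (L0 M)"
  shows "L0_rep a \<in> borel_measurable M"
  using assms L0_rep_class(1) by (auto simp: L0_simps)

lemma L0_class_rep:
  assumes "a \<in> carrier (L0 M)"
  shows "L0_class M (L0_rep a) = a"
  using assms L0_class_cong[OF L0_rep_class(2)] by (auto simp: L0_simps)

lemma L0_class_closed:
  "f \<in> borel_measurable M \<Longrightarrow> L0_class M f \<in> carrier (L0 M)"
  by (simp add: L0_simps)

lemma L0_add_class:
  fixes f g :: "'w \<Rightarrow> 'k::{real_normed_field, euclidean_space}"
  assumes "f \<in> borel_measurable M" "g \<in> borel_measurable M"
  shows "L0_class M f \<oplus>\<^bsub>L0 M\<^esub> L0_class M g = L0_class M (\<lambda>w. f w + g w)"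
  unfolding L0_simps using L0_rep_class(2)[OF assms(1)] L0_rep_class(2)[OF assms(2)]
  by (intro L0_class_cong) auto

lemma L0_mult_class:
  fixes f g :: "'w \<Rightarrow> 'k::{real_normed_field, euclidean_space}"
  assumes "f \<in> borel_measurable M" "g \<in> borel_measurable M"
  shows "L0_class M f \<otimes>\<^bsub>L0 M\<^esub> L0_class M g = L0_class M (\<lambda>w. f w * g w)"
  unfolding L0_simps using L0_rep_class(2)[OF assms(1)] L0_rep_class(2)[OF assms(2)]
  by (intro L0_class_cong) auto

lemma L0_E:
  assumes "a \<in> carrier (L0 M)"
  obtains f where "f \<in> borel_measurable M" "a = L0_class M f"
  using assms by (auto simp: L0_simps)

lemma cring_L0:
  "cring (L0 M :: ('w \<Rightarrow> 'k::{real_normed_field, euclidean_space}) set ring)" (is "cring ?R")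
proof (rule cringI)
  note [simp] = L0_add_class L0_mult_class L0_class_closed L0_simps(4,5)
  show "abelian_group ?R"
  proof (rule abelian_groupI)
    fix a b c assume "a \<in> carrier ?R" "b \<in> carrier ?R" "c \<in> carrier ?R"
    then obtain f g h where f: "f \<in> borel_measurable M" "a = L0_class M f"
      and g: "g \<in> borel_measurable M" "b = L0_class M g"
      and h: "h \<in> borel_measurable M" "c = L0_class M h"
      unfolding L0_simps(1) by blast
    show "a \<oplus>\<^bsub>?R\<^esub> b \<in> carrier ?R"
      using f g by simp
    show "(a \<oplus>\<^bsub>?R\<^esub> b) \<oplus>\<^bsub>?R\<^esub> c = a \<oplus>\<^bsub>?R\<^esub> (b \<oplus>\<^bsub>?R\<^esub> c)"
      using f g h by (simp add: add.assoc)
    show "a \<oplus>\<^bsub>?R\<^esub> b = b \<oplus>\<^bsub>?R\<^esub> a"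
      using f g by (simp add: add.commute)
    show "\<zero>\<^bsub>?R\<^esub> \<oplus>\<^bsub>?R\<^esub> a = a"
      using f by simp
    have "L0_class M (\<lambda>w. - f w) \<oplus>\<^bsub>?R\<^esub> a = \<zero>\<^bsub>?R\<^esub>"
      using f by simp
    moreover have "L0_class M (\<lambda>w. - f w) \<in> carrier ?R"
      using f by (intro L0_class_closed) simp
    ultimately show "\<exists>b\<in>carrier ?R. b \<oplus>\<^bsub>?R\<^esub> a = \<zero>\<^bsub>?R\<^esub>"
      by blast
  qed simp
  show "comm_monoid ?R"
  proof (rule comm_monoidI)
    fix a b c assume "a \<in> carrier ?R" "b \<in> carrier ?R" "c \<in> carrier ?R"
    then obtain f g h where f: "f \<in> borel_measurable M" "a = L0_class M f"
      and g: "g \<in> borel_measurable M" "b = L0_class M g"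
      and h: "h \<in> borel_measurable M" "c = L0_class M h"
      unfolding L0_simps(1) by blast
    show "a \<otimes>\<^bsub>?R\<^esub> b \<in> carrier ?R"
      using f g by simp
    show "(a \<otimes>\<^bsub>?R\<^esub> b) \<otimes>\<^bsub>?R\<^esub> c = a \<otimes>\<^bsub>?R\<^esub> (b \<otimes>\<^bsub>?R\<^esub> c)"
      using f g h by (simp add: mult.assoc)
    show "a \<otimes>\<^bsub>?R\<^esub> b = b \<otimes>\<^bsub>?R\<^esub> a"
      using f g by (simp add: mult.commute)
    show "\<one>\<^bsub>?R\<^esub> \<otimes>\<^bsub>?R\<^esub> a = a"
      using f by simp
  qed simp
  fix a b c assume "a \<in> carrier ?R" "b \<in> carrier ?R" "c \<in> carrier ?R"
  then obtain f g h where f: "f \<in> borel_measurable M" "a = L0_class M f"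
    and g: "g \<in> borel_measurable M" "b = L0_class M g"
    and h: "h \<in> borel_measurable M" "c = L0_class M h"
    unfolding L0_simps(1) by blast
  show "(a \<oplus>\<^bsub>?R\<^esub> b) \<otimes>\<^bsub>?R\<^esub> c = a \<otimes>\<^bsub>?R\<^esub> c \<oplus>\<^bsub>?R\<^esub> b \<otimes>\<^bsub>?R\<^esub> c"
    using f g h by (simp add: distrib_right)
qed


text \<open>
  Seminorms are extensional functions (\<open>\<rightarrow>\<^sub>E\<close>), so that equality of functions is equality on
  the carrier of the module; this matters for the identity of families expressing the countable
  concatenation property of \<open>\<P>\<close>.
\<close>

definition L0_seminorm ::
  "'w measure \<Rightarrow> (('w \<Rightarrow> 'k::real_normed_field) set, 'e, 'z) module_scheme \<Rightarrow>
   ('e \<Rightarrow> ('w \<Rightarrow> real) set) \<Rightarrow> bool" where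
  "L0_seminorm M E p \<longleftrightarrow>
     p \<in> carrier E \<rightarrow>\<^sub>E L0_nonneg M \<and>
     (\<forall>\<xi>\<in>carrier (L0 M). \<forall>x\<in>carrier E. p (\<xi> \<odot>\<^bsub>E\<^esub> x) = L0_abs M \<xi> \<otimes>\<^bsub>L0 M\<^esub> p x) \<and>
     (\<forall>x\<in>carrier E. \<forall>y\<in>carrier E. L0_le M (p (x \<oplus>\<^bsub>E\<^esub> y)) (p x \<oplus>\<^bsub>L0 M\<^esub> p y))"

text \<open>
  A family with no members has no supremum in \<open>L\<^sup>0(\<F>)\<close>, so the last condition entails
  \<open>\<P> \<noteq> {}\<close>.
\<close>

locale random_lc_module =
  prob_space M + Module.module "L0 M" E
  for M :: "'w measure"
    and E :: "(('w \<Rightarrow> 'k::{real_normed_field, euclidean_space}) set, 'e, 'z) module_scheme" +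
  fixes \<P> :: "('e \<Rightarrow> ('w \<Rightarrow> real) set) set"
  assumes seminorms: "\<And>p. p \<in> \<P> \<Longrightarrow> L0_seminorm M E p"
    and separating: "\<And>x. x \<in> carrier E \<Longrightarrow>
      L0_is_Sup M ((\<lambda>p. p x) ` \<P>) \<zero>\<^bsub>L0 M\<^esub> \<longleftrightarrow> x = \<zero>\<^bsub>E\<^esub>"

definition finite_subfamilies :: "'p set \<Rightarrow> 'p set set" where
  "finite_subfamilies \<P> = {\<Q>. \<Q> \<subseteq> \<P> \<and> finite \<Q> \<and> \<Q> \<noteq> {}}"

definition family_norm ::
  "'w measure \<Rightarrow> ('e \<Rightarrow> ('w \<Rightarrow> real) set) set \<Rightarrow> 'e \<Rightarrow> ('w \<Rightarrow> real) set" where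
  "family_norm M \<Q> x = L0_Sup M ((\<lambda>p. p x) ` \<Q>)"

definition cc_hull ::
  "'w measure \<Rightarrow> (('w \<Rightarrow> 'k::real_normed_field) set, 'e, 'z) module_scheme \<Rightarrow>
   ('e \<Rightarrow> ('w \<Rightarrow> real) set) set \<Rightarrow> ('e \<Rightarrow> ('w \<Rightarrow> real) set) set" where
  "cc_hull M E \<P> =
     {\<lambda>x\<in>carrier E. L0_suminf M (\<lambda>n. L0_indicator M (A n) \<otimes>\<^bsub>L0 M\<^esub> family_norm M (\<Q> n) x) | A \<Q>.
        countable_partition M A \<and> (\<forall>n. \<Q> n \<in> finite_subfamilies \<P>)}"

definition cc_family ::
  "'w measure \<Rightarrow> (('w \<Rightarrow> 'k::real_normed_field) set, 'e, 'z) module_scheme \<Rightarrow>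
   ('e \<Rightarrow> ('w \<Rightarrow> real) set) set \<Rightarrow> bool" where
  "cc_family M E \<P> \<longleftrightarrow> cc_hull M E \<P> = \<P>"

definition cc_set ::
  "'w measure \<Rightarrow> (('w \<Rightarrow> 'k::real_normed_field) set, 'e, 'z) module_scheme \<Rightarrow> 'e set \<Rightarrow> bool" where
  "cc_set M E B \<longleftrightarrow>
     (\<forall>X A. range X \<subseteq> B \<and> countable_partition M A \<longrightarrow>
        (\<exists>x\<in>B. \<forall>n::nat. L0_indicator M (A n) \<odot>\<^bsub>E\<^esub> x = L0_indicator M (A n) \<odot>\<^bsub>E\<^esub> X n))"

definition basic_nhd ::
  "'w measure \<Rightarrow> (('w \<Rightarrow> 'k::real_normed_field) set, 'e, 'z) module_scheme \<Rightarrow>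
   ('e \<Rightarrow> ('w \<Rightarrow> real) set) set \<Rightarrow> ('w \<Rightarrow> real) set \<Rightarrow> 'e set" where
  "basic_nhd M E \<Q> \<epsilon> = {x \<in> carrier E. L0_le M (family_norm M \<Q> x) \<epsilon>}"

definition Tc_open ::
  "'w measure \<Rightarrow> (('w \<Rightarrow> 'k::real_normed_field) set, 'e, 'z) module_scheme \<Rightarrow>
   ('e \<Rightarrow> ('w \<Rightarrow> real) set) set \<Rightarrow> 'e set \<Rightarrow> bool" where
  "Tc_open M E \<P> G \<longleftrightarrow> G \<subseteq> carrier E \<and>
     (\<forall>x\<in>G. \<exists>\<Q>\<in>finite_subfamilies \<P>. \<exists>\<epsilon>\<in>L0_pos M. x <+\<^bsub>E\<^esub> basic_nhd M E \<Q> \<epsilon> \<subseteq> G)"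

definition Tc ::
  "'w measure \<Rightarrow> (('w \<Rightarrow> 'k::real_normed_field) set, 'e, 'z) module_scheme \<Rightarrow>
   ('e \<Rightarrow> ('w \<Rightarrow> real) set) set \<Rightarrow> 'e topology" where
  "Tc M E \<P> = topology (Tc_open M E \<P>)"

lemma L0_eqI:
  assumes "a \<in> carrier (L0 M)" "b \<in> carrier (L0 M)" "AE w in M. L0_rep a w = L0_rep b w"
  shows "a = b"
  using L0_class_cong[OF assms(3)] L0_class_rep assms(1,2) by metis

lemma L0_le_antisym:
  assumes "a \<in> carrier (L0 M)" "b \<in> carrier (L0 M)" "L0_le M a b" "L0_le M b a"
  shows "a = b"
  using assms by (intro L0_eqI) (auto simp: L0_le_def elim: eventually_elim2)

lemma L0_le_trans: "L0_le M a b \<Longrightarrow> L0_le M b c \<Longrightarrow> L0_le M a c"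
  unfolding L0_le_def by (auto elim: eventually_elim2)

lemma L0_is_Sup_finite:
  assumes "finite S" "S \<noteq> {}" "S \<subseteq> carrier (L0 M)"
  shows "L0_is_Sup M S (L0_Sup M S)"
proof -
  have ex: "\<exists>s. L0_is_Sup M S s"
    using assms
  proof (induction S rule: finite_ne_induct)
    case (singleton a)
    then show ?case
      by (auto simp: L0_is_Sup_def L0_le_def)
  next
    case (insert a S)
    then obtain s where s: "L0_is_Sup M S s"
      by auto
    have meas: "L0_rep a \<in> borel_measurable M" "L0_rep s \<in> borel_measurable M"
      using insert.prems s by (auto simp: L0_is_Sup_def intro: L0_rep_measurable)
    define t where "t = L0_class M (\<lambda>w. max (L0_rep a w) (L0_rep s w))"
    have t: "AE w in M. L0_rep t w = max (L0_rep a w) (L0_rep s w)" "t \<in> carrier (L0 M)"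
      unfolding t_def using meas by (auto intro!: L0_rep_class L0_class_closed)
    have "L0_le M a t" "L0_le M s t"
      using t(1) unfolding L0_le_def by (eventually_elim, simp)+
    moreover have "L0_le M t u" if "L0_le M a u" "L0_le M s u" for u
      using t(1) that unfolding L0_le_def by eventually_elim simp
    moreover have "L0_le M b t" if "b \<in> S" for b
      using L0_le_trans[OF _ \<open>L0_le M s t\<close>] s that by (simp add: L0_is_Sup_def)
    ultimately have "L0_is_Sup M (insert a S) t"
      using s t(2) by (simp add: L0_is_Sup_def)
    then show ?case ..
  qed
  have "s = t" if "L0_is_Sup M S s" "L0_is_Sup M S t" for s t
    using that unfolding L0_is_Sup_def by (intro L0_le_antisym[where M = M]) simp_all
  with ex have "\<exists>!s. L0_is_Sup M S s"
    by blast
  then show ?thesis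
    unfolding L0_Sup_def by (rule theI')
qed

text \<open>The function \<open>topology\<close> is unspecified on predicates violating \<open>istopology\<close>.\<close>

lemma (in random_lc_module) istopology_Tc_open: "istopology (Tc_open M E \<P>)"
proof -
  have carr: "p x \<in> carrier (L0 M)" if "p \<in> \<P>" "x \<in> carrier E" for p x
    using seminorms[OF that(1)] that(2) by (auto simp: L0_seminorm_def L0_nonneg_def)
  have Sup: "L0_is_Sup M ((\<lambda>p. p x) ` \<Q>) (family_norm M \<Q> x)"
    if "\<Q> \<in> finite_subfamilies \<P>" "x \<in> carrier E" for \<Q> x
  proof -
    have "finite \<Q>" "\<Q> \<noteq> {}" "\<Q> \<subseteq> \<P>"
      using that(1) by (simp_all add: finite_subfamilies_def)
    moreover from this have "(\<lambda>p. p x) ` \<Q> \<subseteq> carrier (L0 M)"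
      using carr[OF _ that(2)] by (intro image_subsetI) (simp add: subsetD)
    ultimately show ?thesis
      unfolding family_norm_def by (intro L0_is_Sup_finite) simp_all
  qed
  have mono: "basic_nhd M E \<R> \<delta> \<subseteq> basic_nhd M E \<Q> \<epsilon>"
    if "\<Q> \<in> finite_subfamilies \<P>" "\<R> \<in> finite_subfamilies \<P>" "\<Q> \<subseteq> \<R>" "L0_le M \<delta> \<epsilon>"
    for \<Q> \<R> \<delta> \<epsilon>
  proof
    fix x assume x: "x \<in> basic_nhd M E \<R> \<delta>"
    then have "x \<in> carrier E" and le: "L0_le M (family_norm M \<R> x) \<delta>"
      by (simp_all add: basic_nhd_def)
    note Q = Sup[OF that(1) this(1)] and R = Sup[OF that(2) this(1)]
    have "L0_le M (p x) (family_norm M \<R> x)" if "p \<in> \<Q>" for p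
      using R that \<open>\<Q> \<subseteq> \<R>\<close> by (auto simp: L0_is_Sup_def)
    then have "L0_le M (family_norm M \<Q> x) (family_norm M \<R> x)"
      using Q R by (simp add: L0_is_Sup_def)
    then have "L0_le M (family_norm M \<Q> x) \<epsilon>"
      using L0_le_trans le that(4) by metis
    with \<open>x \<in> carrier E\<close> show "x \<in> basic_nhd M E \<Q> \<epsilon>"
      by (simp add: basic_nhd_def)
  qed
  have "Tc_open M E \<P> (G \<inter> H)" if opens: "Tc_open M E \<P> G" "Tc_open M E \<P> H" for G H
    unfolding Tc_open_def
  proof (intro conjI ballI)
    show "G \<inter> H \<subseteq> carrier E"
      using opens by (auto simp: Tc_open_def)
    fix x assume "x \<in> G \<inter> H"
    then obtain \<Q> \<epsilon> \<R> \<delta> where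
      Q: "\<Q> \<in> finite_subfamilies \<P>" "\<epsilon> \<in> L0_pos M" "x <+\<^bsub>E\<^esub> basic_nhd M E \<Q> \<epsilon> \<subseteq> G" and
      R: "\<R> \<in> finite_subfamilies \<P>" "\<delta> \<in> L0_pos M" "x <+\<^bsub>E\<^esub> basic_nhd M E \<R> \<delta> \<subseteq> H"
      using opens unfolding Tc_open_def by (meson IntD1 IntD2)
    define \<gamma> where "\<gamma> = L0_class M (\<lambda>w. min (L0_rep \<epsilon> w) (L0_rep \<delta> w))"
    have meas: "L0_rep \<epsilon> \<in> borel_measurable M" "L0_rep \<delta> \<in> borel_measurable M"
      using Q(2) R(2) by (auto simp: L0_pos_def intro: L0_rep_measurable)
    have g: "AE w in M. L0_rep \<gamma> w = min (L0_rep \<epsilon> w) (L0_rep \<delta> w)" "\<gamma> \<in> carrier (L0 M)"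
      unfolding \<gamma>_def using meas by (auto intro!: L0_rep_class L0_class_closed)
    have le: "L0_le M \<gamma> \<epsilon>" "L0_le M \<gamma> \<delta>"
      using g(1) unfolding L0_le_def by (eventually_elim, simp)+
    have "AE w in M. 0 < L0_rep \<epsilon> w" "AE w in M. 0 < L0_rep \<delta> w"
      using Q(2) R(2) by (auto simp: L0_pos_def)
    with g(1) have "AE w in M. 0 < L0_rep \<gamma> w"
      by eventually_elim simp
    with g(2) have pos: "\<gamma> \<in> L0_pos M"
      by (simp add: L0_pos_def)
    have QR: "\<Q> \<union> \<R> \<in> finite_subfamilies \<P>"
      using Q(1) R(1) by (auto simp: finite_subfamilies_def)
    have "basic_nhd M E (\<Q> \<union> \<R>) \<gamma> \<subseteq> basic_nhd M E \<Q> \<epsilon> \<inter> basic_nhd M E \<R> \<delta>"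
      using mono[OF Q(1) QR _ le(1)] mono[OF R(1) QR _ le(2)] by auto
    then have "x <+\<^bsub>E\<^esub> basic_nhd M E (\<Q> \<union> \<R>) \<gamma> \<subseteq> G \<inter> H"
      using Q(3) R(3) unfolding a_l_coset_def' by blast
    with QR pos show "\<exists>\<Q>\<in>finite_subfamilies \<P>. \<exists>\<epsilon>\<in>L0_pos M.
        x <+\<^bsub>E\<^esub> basic_nhd M E \<Q> \<epsilon> \<subseteq> G \<inter> H"
      by blast
  qed
  moreover have "Tc_open M E \<P> (\<Union>\<G>)" if opens: "\<forall>G\<in>\<G>. Tc_open M E \<P> G" for \<G>
    unfolding Tc_open_def
  proof (intro conjI ballI)
    show "\<Union>\<G> \<subseteq> carrier E"
      using opens by (auto simp: Tc_open_def)
    fix x assume "x \<in> \<Union>\<G>"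
    then obtain G where G: "G \<in> \<G>" "x \<in> G"
      by blast
    then obtain \<Q> \<epsilon> where "\<Q> \<in> finite_subfamilies \<P>" "\<epsilon> \<in> L0_pos M"
        "x <+\<^bsub>E\<^esub> basic_nhd M E \<Q> \<epsilon> \<subseteq> G"
      using opens unfolding Tc_open_def by meson
    with G(1) show "\<exists>\<Q>\<in>finite_subfamilies \<P>. \<exists>\<epsilon>\<in>L0_pos M.
        x <+\<^bsub>E\<^esub> basic_nhd M E \<Q> \<epsilon> \<subseteq> \<Union>\<G>"
      by blast
  qed
  ultimately show ?thesis
    unfolding istopology_def by blast
qed

lemma (in random_lc_module) openin_Tc: "openin (Tc M E \<P>) G \<longleftrightarrow> Tc_open M E \<P> G"
  unfolding Tc_def by (simp add: istopology_Tc_open)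

definition nhd_in :: "'a topology \<Rightarrow> 'a \<Rightarrow> 'a set \<Rightarrow> bool" where
  "nhd_in T x U \<longleftrightarrow> U \<subseteq> topspace T \<and> (\<exists>G. openin T G \<and> x \<in> G \<and> G \<subseteq> U)"

definition ind_image ::
  "'w measure \<Rightarrow> (('w \<Rightarrow> 'k::real_normed_field) set, 'e, 'z) module_scheme \<Rightarrow>
   'w set \<Rightarrow> 'e set \<Rightarrow> 'e set" where
  "ind_image M E A G = (\<lambda>g. L0_indicator M A \<odot>\<^bsub>E\<^esub> g) ` G"

definition L0_convex ::
  "'w measure \<Rightarrow> (('w \<Rightarrow> 'k::real_normed_field) set, 'e, 'z) module_scheme \<Rightarrow> 'e set \<Rightarrow> bool" where
  "L0_convex M E B \<longleftrightarrow>
     (\<forall>x\<in>B. \<forall>y\<in>B. \<forall>\<xi>\<in>L0_nonneg M. L0_le M \<xi> \<one>\<^bsub>L0 M\<^esub> \<longrightarrow>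
        L0_of_real M \<xi> \<odot>\<^bsub>E\<^esub> x \<oplus>\<^bsub>E\<^esub> L0_of_real M (\<one>\<^bsub>L0 M\<^esub> \<ominus>\<^bsub>L0 M\<^esub> \<xi>) \<odot>\<^bsub>E\<^esub> y \<in> B)"

definition L0_balanced ::
  "'w measure \<Rightarrow> (('w \<Rightarrow> 'k::real_normed_field) set, 'e, 'z) module_scheme \<Rightarrow> 'e set \<Rightarrow> bool" where
  "L0_balanced M E B \<longleftrightarrow>
     (\<forall>\<eta>\<in>carrier (L0 M). L0_le M (L0_abs M \<eta>) \<one>\<^bsub>L0 M\<^esub> \<longrightarrow> (\<lambda>x. \<eta> \<odot>\<^bsub>E\<^esub> x) ` B \<subseteq> B)"

definition L0_absorbent ::
  "'w measure \<Rightarrow> (('w \<Rightarrow> 'k::real_normed_field) set, 'e, 'z) module_scheme \<Rightarrow> 'e set \<Rightarrow> bool" where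
  "L0_absorbent M E B \<longleftrightarrow>
     (\<forall>x\<in>carrier E. \<exists>\<xi>\<in>L0_pos M. \<forall>\<eta>\<in>carrier (L0 M).
        L0_le M (L0_abs M \<eta>) \<xi> \<longrightarrow> \<eta> \<odot>\<^bsub>E\<^esub> x \<in> B)"

end

theory Submission
  imports Defs
begin

text \<open>
  Call a set \<open>A\<close> good if some seminorm \<open>p \<in> \<P>\<close> and some positive \<open>\<epsilon>\<close> satisfy
  \<open>p (y - x) > \<epsilon>\<close> almost surely on \<open>A\<close> for every \<open>y\<close> in the closed set. Since \<open>\<P>\<close> is closed under
  countable concatenation, so are the good sets, hence there is an essentially largest good set
  \<open>H\<close>. If its complement \<open>D\<close> had positive probability, then for every \<open>p\<close> and \<open>\<epsilon>\<close> a second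
  exhaustion, now gluing points of the closed set, would yield one \<open>y\<close> with \<open>p (y - x) \<le> \<epsilon>\<close> on
  all of \<open>D\<close>: a part of \<open>D\<close> where no point comes that close would be good. So the point that equals
  \<open>x\<close> on \<open>D\<close> and some \<open>y\<^sub>0\<close> of the closed set on \<open>H\<close> would lie in its closure, contrary to
  the disjointness on \<open>D\<close>. With the \<open>p\<close> and \<open>\<epsilon>\<close> that belong to \<open>H\<close>, the ball
  \<open>p \<le> \<epsilon> / 2\<close> is the required neighbourhood.
\<close>

section \<open>Disjoint series and exhaustion in a finite measure space\<close>

lemma suminf_indicator_disjoint:
  fixes f :: "nat \<Rightarrow> real"
  assumes "disjoint_family A" "w \<in> A m"
  shows "(\<Sum>n. indicator (A n) w * f n) = f m"
proof -
  have "indicator (A n) w * f n = 0" if "n \<noteq> m" for n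
    using that assms by (auto simp: disjoint_family_on_def indicator_def)
  then have "(\<Sum>n. indicator (A n) w * f n) = (\<Sum>n\<in>{m}. indicator (A n) w * f n)"
    by (intro suminf_finite) auto
  then show ?thesis
    using assms(2) by simp
qed

text \<open>The supremum of the measures of sets with \<Phi> is attained: sets whose measures
  approach it have a union \<open>H\<close> that again satisfies \<Phi>. A set with \<Phi> that
  misses \<open>H\<close> and has positive measure would, joined to \<open>H\<close>, exceed the
  supremum.\<close>

lemma (in finite_measure) exhaustion:
  assumes sub: "\<And>A. \<Phi> A \<Longrightarrow> A \<in> sets M"
    and mono: "\<And>A B. \<Phi> A \<Longrightarrow> B \<in> sets M \<Longrightarrow> B \<subseteq> A \<Longrightarrow> \<Phi> B"
    and Union: "\<And>A :: nat \<Rightarrow> 'a set. (\<And>n. \<Phi> (A n)) \<Longrightarrow> disjoint_family A \<Longrightarrow> \<Phi> (\<Union>n. A n)"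
    and empty: "\<Phi> {}"
  obtains H where "\<Phi> H" "\<And>A. \<Phi> A \<Longrightarrow> A \<inter> H = {} \<Longrightarrow> measure M A = 0"
proof -
  let ?S = "measure M ` Collect \<Phi>"
  have bdd: "bdd_above ?S"
    by (intro bdd_aboveI[of _ "measure M (space M)"]) (auto intro: bounded_measure)
  have "\<exists>A. \<Phi> A \<and> Sup ?S - 1 / Suc n < measure M A" for n
  proof -
    have "Sup ?S - 1 / Suc n < Sup ?S"
      by simp
    moreover have "?S \<noteq> {}"
      using empty by blast
    ultimately obtain a where "a \<in> ?S" "Sup ?S - 1 / Suc n < a"
      using less_cSupE by metis
    then show ?thesis
      by blast
  qed
  then obtain A where A: "\<And>n::nat. \<Phi> (A n)" "\<And>n. Sup ?S - 1 / Suc n < measure M (A n)"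
    by metis
  define H where "H = (\<Union>n. A n)"
  have [measurable]: "A n \<in> sets M" for n
    using A(1) sub by blast
  \<comment> \<open>\<open>Union\<close> accepts disjoint sequences only, so each \<open>A n\<close>
    is first cut down to a subset, which \<open>mono\<close> permits; the union stays the
    same.\<close>
  have "\<Phi> (disjointed A n)" for n
    using sets.range_disjointed_sets[OF image_subsetI, of A M] \<open>\<And>n. A n \<in> sets M\<close>
    by (intro mono[OF A(1)[of n]] disjointed_subset) blast
  then have H: "\<Phi> H"
    using Union[of "disjointed A"] by (simp add: disjoint_family_disjointed UN_disjointed_eq H_def)
  have ge: "Sup ?S \<le> measure M H"
  proof (rule field_le_epsilon)
    fix e :: real assume "0 < e"
    then obtain n where n: "1 / Suc n < e"
      using nat_approx_posE by blast
    have "measure M (A n) \<le> measure M H"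
      using sub[OF H] by (intro finite_measure_mono) (auto simp: H_def)
    with A(2)[of n] n show "Sup ?S \<le> measure M H + e"
      by simp
  qed
  have "measure M B = 0" if B: "\<Phi> B" "B \<inter> H = {}" for B
  proof -
    \<comment> \<open>Padding with empty sets turns the two sets into a sequence, the form that
      \<open>Union\<close> takes.\<close>
    let ?C = "\<lambda>n::nat. if n = 0 then B else if n = 1 then H else {}"
    have "(\<Union>n. ?C n) = B \<union> H"
      by (auto split: if_splits intro: exI[of _ "0::nat"] exI[of _ "1::nat"])
    moreover have "disjoint_family ?C"
      using B(2) by (auto simp: disjoint_family_on_def)
    ultimately have "\<Phi> (B \<union> H)"
      using Union[of ?C] B(1) H empty by simp
    then have "measure M (B \<union> H) \<le> Sup ?S"
      using bdd by (intro cSup_upper) auto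
    moreover have "measure M (B \<union> H) = measure M B + measure M H"
      using B sub H by (intro finite_measure_Union) auto
    ultimately show ?thesis
      using ge measure_nonneg[of M B] by linarith
  qed
  with H that show thesis
    by blast
qed

section \<open>Almost sure arithmetic of representatives\<close>

lemma L0_uminus_class:
  fixes f :: "'w \<Rightarrow> 'k::{real_normed_field, euclidean_space}"
  assumes [measurable]: "f \<in> borel_measurable M"
  shows "\<ominus>\<^bsub>L0 M\<^esub> L0_class M f = L0_class M (\<lambda>w. - f w)"
proof -
  interpret cring "L0 M :: ('w \<Rightarrow> 'k) set ring"
    by (rule cring_L0)
  show ?thesis
    by (rule minus_equality) (auto simp: L0_add_class L0_class_closed L0_simps(5))
qed

lemma L0_rep_add:
  fixes a b :: "('w \<Rightarrow> 'k::{real_normed_field, euclidean_space}) set"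
  assumes "a \<in> carrier (L0 M)" "b \<in> carrier (L0 M)"
  shows "AE w in M. L0_rep (a \<oplus>\<^bsub>L0 M\<^esub> b) w = L0_rep a w + L0_rep b w"
  unfolding L0_simps(3) using assms[THEN L0_rep_measurable] by (intro L0_rep_class) measurable

lemma L0_rep_mult:
  fixes a b :: "('w \<Rightarrow> 'k::{real_normed_field, euclidean_space}) set"
  assumes "a \<in> carrier (L0 M)" "b \<in> carrier (L0 M)"
  shows "AE w in M. L0_rep (a \<otimes>\<^bsub>L0 M\<^esub> b) w = L0_rep a w * L0_rep b w"
  unfolding L0_simps(2) using assms[THEN L0_rep_measurable] by (intro L0_rep_class) measurable

lemma L0_rep_one_minus:
  fixes a :: "('w \<Rightarrow> 'k::{real_normed_field, euclidean_space}) set"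
  assumes "a \<in> carrier (L0 M)"
  shows "AE w in M. L0_rep (\<one>\<^bsub>L0 M\<^esub> \<ominus>\<^bsub>L0 M\<^esub> a) w = 1 - L0_rep a w"
proof -
  obtain f where f [measurable]: "f \<in> borel_measurable M" and a: "a = L0_class M f"
    using assms by (rule L0_E)
  have "\<one>\<^bsub>L0 M\<^esub> \<ominus>\<^bsub>L0 M\<^esub> a = L0_class M (\<lambda>w. 1 - f w)"
    unfolding a a_minus_def L0_uminus_class[OF f] L0_simps(4) by (subst L0_add_class) auto
  moreover have "AE w in M. L0_rep (L0_class M (\<lambda>w. 1 - f w)) w = 1 - f w"
    by (rule L0_rep_class) measurable
  ultimately show ?thesis
    using L0_rep_class(2)[OF f] unfolding a by auto
qed

lemma L0_rep_abs:
  fixes a :: "('w \<Rightarrow> 'k::{real_normed_field, euclidean_space}) set"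
  assumes "a \<in> carrier (L0 M)"
  shows "AE w in M. L0_rep (L0_abs M a) w = norm (L0_rep a w)"
    and "L0_abs M a \<in> carrier (L0 M)"
  unfolding L0_abs_def using assms[THEN L0_rep_measurable]
  by (auto intro!: L0_rep_class L0_class_closed)

lemma L0_rep_of_real:
  fixes a :: "('w \<Rightarrow> real) set"
  assumes "a \<in> carrier (L0 M)"
  shows "AE w in M. L0_rep (L0_of_real M a) w
      = (of_real (L0_rep a w) :: 'k::{real_normed_field, euclidean_space})"
    and "L0_of_real M a \<in> carrier (L0 M :: ('w \<Rightarrow> 'k) set ring)"
proof -
  have [measurable]: "L0_rep a \<in> borel_measurable M"
    using assms by (rule L0_rep_measurable)
  have "(\<lambda>w. of_real (L0_rep a w) :: 'k) \<in> borel_measurable M"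
    by measurable
  then show "AE w in M. L0_rep (L0_of_real M a) w = (of_real (L0_rep a w) :: 'k)"
    "L0_of_real M a \<in> carrier (L0 M :: ('w \<Rightarrow> 'k) set ring)"
    unfolding L0_of_real_def by (auto intro!: L0_rep_class L0_class_closed)
qed

lemma L0_rep_indicator:
  assumes "A \<in> sets M"
  shows "AE w in M. L0_rep (L0_indicator M A) w = (indicator A w :: 'k::{real_normed_field, euclidean_space})"
    and "L0_indicator M A \<in> carrier (L0 M :: ('w \<Rightarrow> 'k) set ring)"
  unfolding L0_indicator_def using assms by (auto intro!: L0_rep_class L0_class_closed)

lemma L0_indicator_mult:
  assumes "A \<in> sets M" "B \<in> sets M"
  shows "L0_indicator M A \<otimes>\<^bsub>L0 M\<^esub> L0_indicator M B
    = (L0_indicator M (A \<inter> B) :: ('w \<Rightarrow> 'k::{real_normed_field, euclidean_space}) set)"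
  unfolding L0_indicator_def using assms
  by (simp add: L0_mult_class indicator_inter_arith[symmetric])

lemma L0_indicator_empty: "L0_indicator M {} = \<zero>\<^bsub>L0 M\<^esub>"
  unfolding L0_indicator_def L0_simps by (intro L0_class_cong) simp

text \<open>Concatenation is stated for partitions of the whole space, while exhaustion deals with
  disjoint sequences that may leave a gap. The gap is put at index 0, which moves \<open>A n\<close>
  to index \<open>Suc n\<close>.\<close>

lemma countable_partition_case_nat:
  assumes "range A \<subseteq> sets M" "disjoint_family A"
  shows "countable_partition M (case_nat (space M - (\<Union>n. A n)) A)"
  unfolding countable_partition_def
proof (intro conjI)
  have sets: "A n \<in> sets M" for n
    using assms(1) by auto
  show "range (case_nat (space M - (\<Union>n. A n)) A) \<subseteq> sets M"
    using sets by (auto split: nat.split)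
  show "disjoint_family (case_nat (space M - (\<Union>n. A n)) A)"
    using assms(2) by (auto simp: disjoint_family_on_def split: nat.split)
  have "A n \<subseteq> space M" for n
    using sets sets.sets_into_space by blast
  moreover have "(\<Union>n. case_nat (space M - (\<Union>n. A n)) A n) = (space M - (\<Union>n. A n)) \<union> (\<Union>n. A n)"
    by (subst UNIV_nat_eq) simp
  ultimately show "(\<Union>n. case_nat (space M - (\<Union>n. A n)) A n) = space M"
    by blast
qed

lemma cc_setD:
  assumes cc: "cc_set M E B"
    and A: "range A \<subseteq> sets M" "disjoint_family A" and X: "range X \<subseteq> B"
  obtains x where "x \<in> B"
    "\<And>n::nat. L0_indicator M (A n) \<odot>\<^bsub>E\<^esub> x = L0_indicator M (A n) \<odot>\<^bsub>E\<^esub> X n"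
proof -
  \<comment> \<open>Any member of \<open>B\<close> may be prescribed on the gap; \<open>X 0\<close>
    is at hand.\<close>
  have "range (case_nat (X 0) X) \<subseteq> B"
    using X by (auto split: nat.split)
  with cc countable_partition_case_nat[OF A] obtain x where "x \<in> B" and
    x: "\<And>n. L0_indicator M (case_nat (space M - (\<Union>n. A n)) A n) \<odot>\<^bsub>E\<^esub> x
      = L0_indicator M (case_nat (space M - (\<Union>n. A n)) A n) \<odot>\<^bsub>E\<^esub> case_nat (X 0) X n"
    unfolding cc_set_def by meson
  show thesis
    using that[OF \<open>x \<in> B\<close>] x[of "Suc _"] by simp
qed

section \<open>Pointwise laws of the seminorms\<close>

context random_lc_module
begin

lemma seminorm_in_nonneg:
  assumes "p \<in> \<P>" "x \<in> carrier E"
  shows "p x \<in> L0_nonneg M"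
  using seminorms[OF assms(1)] assms(2) unfolding L0_seminorm_def by blast

lemma seminorm_closed: "p \<in> \<P> \<Longrightarrow> x \<in> carrier E \<Longrightarrow> p x \<in> carrier (L0 M)"
  using seminorm_in_nonneg by (simp add: L0_nonneg_def)

lemma seminorm_measurable: "p \<in> \<P> \<Longrightarrow> x \<in> carrier E \<Longrightarrow> L0_rep (p x) \<in> borel_measurable M"
  by (intro L0_rep_measurable seminorm_closed)

lemma seminorm_nonneg:
  assumes "p \<in> \<P>" "x \<in> carrier E"
  shows "AE w in M. 0 \<le> L0_rep (p x) w"
proof -
  have "L0_le M \<zero>\<^bsub>L0 M\<^esub> (p x)"
    using seminorm_in_nonneg[OF assms] by (simp add: L0_nonneg_def)
  moreover have "AE w in M. L0_rep (\<zero>\<^bsub>L0 M\<^esub>) w = (0::real)"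
    unfolding L0_simps by (rule L0_rep_class) simp
  ultimately show ?thesis
    unfolding L0_le_def by eventually_elim simp
qed

lemma seminorm_smult:
  assumes "p \<in> \<P>" "x \<in> carrier E" "a \<in> carrier (L0 M)"
  shows "AE w in M. L0_rep (p (a \<odot>\<^bsub>E\<^esub> x)) w = norm (L0_rep a w) * L0_rep (p x) w"
proof -
  have eq: "p (a \<odot>\<^bsub>E\<^esub> x) = L0_abs M a \<otimes>\<^bsub>L0 M\<^esub> p x"
    using seminorms[OF assms(1)] assms by (auto simp: L0_seminorm_def)
  show ?thesis
    unfolding eq using L0_rep_mult[OF L0_rep_abs(2)[OF assms(3)] seminorm_closed[OF assms(1,2)]]
      L0_rep_abs(1)[OF assms(3)] by eventually_elim simp
qed

lemma seminorm_add:
  assumes "p \<in> \<P>" "x \<in> carrier E" "y \<in> carrier E"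
  shows "AE w in M. L0_rep (p (x \<oplus>\<^bsub>E\<^esub> y)) w \<le> L0_rep (p x) w + L0_rep (p y) w"
proof -
  have "L0_le M (p (x \<oplus>\<^bsub>E\<^esub> y)) (p x \<oplus>\<^bsub>L0 M\<^esub> p y)"
    using seminorms[OF assms(1)] assms by (auto simp: L0_seminorm_def)
  then show ?thesis
    unfolding L0_le_def using L0_rep_add[OF seminorm_closed[OF assms(1,2)] seminorm_closed[OF assms(1,3)]]
    by eventually_elim simp
qed

lemma seminorm_uminus:
  assumes "p \<in> \<P>" "x \<in> carrier E"
  shows "AE w in M. L0_rep (p (\<ominus>\<^bsub>E\<^esub> x)) w = L0_rep (p x) w"
proof -
  have eq: "\<ominus>\<^bsub>E\<^esub> x = L0_class M (\<lambda>w. - 1) \<odot>\<^bsub>E\<^esub> x"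
    using smult_l_minus[OF R.one_closed assms(2)] assms(2)
    by (simp add: L0_simps(4) L0_uminus_class smult_one[unfolded L0_simps(4)])
  have "AE w in M. L0_rep (L0_class M (\<lambda>w. - 1 :: 'k)) w = - 1"
    by (rule L0_rep_class) simp
  moreover have "L0_class M (\<lambda>w. - 1 :: 'k) \<in> carrier (L0 M)"
    by (rule L0_class_closed) simp
  ultimately show ?thesis
    unfolding eq using seminorm_smult[OF assms, of "L0_class M (\<lambda>w. - 1)"] by auto
qed

lemma seminorm_zero:
  assumes "p \<in> \<P>"
  shows "AE w in M. L0_rep (p \<zero>\<^bsub>E\<^esub>) w = 0"
proof -
  have "AE w in M. L0_rep (\<zero>\<^bsub>L0 M\<^esub>) w = (0::'k)"
    unfolding L0_simps by (rule L0_rep_class) simp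
  moreover have "\<zero>\<^bsub>L0 M\<^esub> \<odot>\<^bsub>E\<^esub> \<zero>\<^bsub>E\<^esub> = \<zero>\<^bsub>E\<^esub>"
    by simp
  ultimately show ?thesis
    using seminorm_smult[OF assms M.zero_closed R.zero_closed] by auto
qed

text \<open>By homogeneity, multiplying a vector by an indicator multiplies its \<open>p\<close> by
  that indicator, so \<open>p\<close> on \<open>A\<close> sees only the part of the vector on
  \<open>A\<close>. This locality allows glued points to be estimated piece by piece.\<close>

lemma seminorm_eq_on:
  assumes "p \<in> \<P>" "x \<in> carrier E" "y \<in> carrier E" "A \<in> sets M"
    and eq: "L0_indicator M A \<odot>\<^bsub>E\<^esub> x = L0_indicator M A \<odot>\<^bsub>E\<^esub> y"
  shows "AE w in M. w \<in> A \<longrightarrow> L0_rep (p x) w = L0_rep (p y) w"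
  using seminorm_smult[OF assms(1,2) L0_rep_indicator(2)[OF assms(4)]]
    seminorm_smult[OF assms(1,3) L0_rep_indicator(2)[OF assms(4)]]
    L0_rep_indicator(1)[OF assms(4), where 'k = 'k]
  unfolding eq by eventually_elim auto

lemma minus_add_cancel_left:
  assumes "a \<in> carrier E" "b \<in> carrier E" "c \<in> carrier E"
  shows "(c \<oplus>\<^bsub>E\<^esub> a) \<ominus>\<^bsub>E\<^esub> (c \<oplus>\<^bsub>E\<^esub> b) = a \<ominus>\<^bsub>E\<^esub> b"
proof -
  have "(a \<oplus>\<^bsub>E\<^esub> c) \<oplus>\<^bsub>E\<^esub> (\<ominus>\<^bsub>E\<^esub> c \<oplus>\<^bsub>E\<^esub> \<ominus>\<^bsub>E\<^esub> b) = a \<oplus>\<^bsub>E\<^esub> \<ominus>\<^bsub>E\<^esub> b"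
    using assms by (simp add: M.a_assoc M.r_neg2)
  then show ?thesis
    using assms by (simp add: a_minus_def M.minus_add M.a_comm[of a c])
qed

lemma indicator_smult_minus:
  assumes "x \<in> carrier E" "y \<in> carrier E" "z \<in> carrier E" "A \<in> sets M"
    and eq: "L0_indicator M A \<odot>\<^bsub>E\<^esub> x = L0_indicator M A \<odot>\<^bsub>E\<^esub> y"
  shows "L0_indicator M A \<odot>\<^bsub>E\<^esub> (x \<ominus>\<^bsub>E\<^esub> z) = L0_indicator M A \<odot>\<^bsub>E\<^esub> (y \<ominus>\<^bsub>E\<^esub> z)"
  using assms L0_rep_indicator(2)[OF assms(4), where 'k = 'k]
  by (simp add: a_minus_def smult_r_distr)

text \<open>Indicators are idempotent and those of disjoint sets multiply to zero, so the second
  summand vanishes on \<open>A\<close>.\<close>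

lemma indicator_smult_glue:
  assumes "x \<in> carrier E" "y \<in> carrier E" "A \<in> sets M" "B \<in> sets M" "A \<inter> B = {}"
  shows "L0_indicator M A \<odot>\<^bsub>E\<^esub> (L0_indicator M A \<odot>\<^bsub>E\<^esub> x \<oplus>\<^bsub>E\<^esub> L0_indicator M B \<odot>\<^bsub>E\<^esub> y)
    = L0_indicator M A \<odot>\<^bsub>E\<^esub> x"
  using assms L0_rep_indicator(2)[OF assms(3), where 'k = 'k] L0_rep_indicator(2)[OF assms(4), where 'k = 'k]
  by (simp add: smult_r_distr smult_assoc1[symmetric] L0_indicator_mult L0_indicator_empty)

section \<open>Concatenation of seminorms\<close>

lemma family_norm_closed:
  assumes "\<Q> \<in> finite_subfamilies \<P>" "x \<in> carrier E"
  shows "family_norm M \<Q> x \<in> carrier (L0 M)"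
proof -
  have "finite \<Q>" "\<Q> \<noteq> {}" "\<Q> \<subseteq> \<P>"
    using assms(1) by (simp_all add: finite_subfamilies_def)
  moreover from this have "(\<lambda>p. p x) ` \<Q> \<subseteq> carrier (L0 M)"
    using seminorm_closed[OF _ assms(2)] by blast
  ultimately have "L0_is_Sup M ((\<lambda>p. p x) ` \<Q>) (family_norm M \<Q> x)"
    unfolding family_norm_def by (intro L0_is_Sup_finite) simp_all
  then show ?thesis
    by (simp add: L0_is_Sup_def)
qed

lemma family_norm_singleton:
  assumes "p \<in> \<P>" "x \<in> carrier E"
  shows "family_norm M {p} x = p x"
proof -
  have "L0_is_Sup M {p x} (family_norm M {p} x)"
    using L0_is_Sup_finite[of "{p x}" M] seminorm_closed[OF assms] by (simp add: family_norm_def)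
  then have "L0_le M (p x) (family_norm M {p} x)" "L0_le M (family_norm M {p} x) (p x)"
    "family_norm M {p} x \<in> carrier (L0 M)"
    using seminorm_closed[OF assms] by (auto simp: L0_is_Sup_def) (auto simp: L0_le_def)
  then show ?thesis
    using L0_le_antisym seminorm_closed[OF assms] by metis
qed

text \<open>At a point of \<open>A n\<close> only one term of the series that defines a member of
  \<open>cc_hull\<close> can be nonzero. The gap outside the sets \<open>A n\<close> receives the
  family \<open>\<Q> 0\<close>. As the terms are countably many, their almost sure formulas hold
  simultaneously.\<close>

lemma cc_familyD:
  assumes cc: "cc_family M E \<P>"
    and A: "range A \<subseteq> sets M" "disjoint_family A"
    and Q: "\<And>n::nat. \<Q> n \<in> finite_subfamilies \<P>"
  obtains q where "q \<in> \<P>"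
    "\<And>n x. x \<in> carrier E \<Longrightarrow>
      AE w in M. w \<in> A n \<longrightarrow> L0_rep (q x) w = L0_rep (family_norm M (\<Q> n) x) w"
proof -
  let ?B = "case_nat (space M - (\<Union>n. A n)) A" and ?R = "case_nat (\<Q> 0) \<Q>"
  define q where "q = (\<lambda>x\<in>carrier E.
    L0_suminf M (\<lambda>n. L0_indicator M (?B n) \<otimes>\<^bsub>L0 M\<^esub> family_norm M (?R n) x))"
  have B: "countable_partition M ?B"
    by (rule countable_partition_case_nat[OF A])
  have R: "?R n \<in> finite_subfamilies \<P>" for n
    using Q by (simp split: nat.split)
  have "q \<in> cc_hull M E \<P>"
    unfolding cc_hull_def q_def using B R by blast
  then have "q \<in> \<P>"
    using cc by (simp add: cc_family_def)
  moreover have "AE w in M. w \<in> A n \<longrightarrow> L0_rep (q x) w = L0_rep (family_norm M (\<Q> n) x) w"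
    if x: "x \<in> carrier E" for n x
  proof -
    let ?t = "\<lambda>n. L0_indicator M (?B n) \<otimes>\<^bsub>L0 M\<^esub> family_norm M (?R n) x"
    have B_sets: "?B n \<in> sets M" for n
      using B by (auto simp: countable_partition_def)
    have disj: "disjoint_family ?B"
      using B by (simp add: countable_partition_def)
    have t: "?t n \<in> carrier (L0 M)" for n
      using L0_rep_measurable[OF L0_rep_indicator(2)[OF B_sets[of n], where 'k = real]]
        L0_rep_measurable[OF family_norm_closed[OF R[of n] x]]
      unfolding L0_simps(2) by (intro L0_class_closed) measurable
    have "AE w in M. L0_rep (?t n) w = indicator (?B n) w * L0_rep (family_norm M (?R n) x) w" for n
      using L0_rep_mult[OF L0_rep_indicator(2)[OF B_sets[of n]] family_norm_closed[OF R[of n] x]]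
        L0_rep_indicator(1)[OF B_sets[of n], where 'k = real] by eventually_elim simp
    then have "AE w in M. \<forall>n. L0_rep (?t n) w = indicator (?B n) w * L0_rep (family_norm M (?R n) x) w"
      unfolding AE_all_countable by (rule allI)
    moreover have "AE w in M. L0_rep (q x) w = (\<Sum>n. L0_rep (?t n) w)"
    proof -
      have "(\<lambda>w. \<Sum>n. L0_rep (?t n) w) \<in> borel_measurable M"
        by (intro borel_measurable_suminf L0_rep_measurable[OF t])
      from L0_rep_class(2)[OF this] show ?thesis
        using x by (simp add: q_def L0_suminf_def)
    qed
    ultimately show ?thesis
    proof eventually_elim
      case (elim w)
      show ?case
      proof
        assume "w \<in> A n"
        \<comment> \<open>The surviving index is \<open>Suc n\<close>, because index 0 of
          \<open>?B\<close> is the gap.\<close>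
        then show "L0_rep (q x) w = L0_rep (family_norm M (\<Q> n) x) w"
          using elim suminf_indicator_disjoint[OF disj, of w "Suc n" "\<lambda>n. L0_rep (family_norm M (?R n) x) w"]
          by simp
      qed
    qed
  qed
  ultimately show thesis
    using that by blast
qed

text \<open>Concatenation along the trivial partition, the whole space followed by empty sets,
  suffices. Finite families can thus be traded for single members of \<open>\<P>\<close>.\<close>

lemma family_norm_in_cc:
  assumes "cc_family M E \<P>" "\<Q> \<in> finite_subfamilies \<P>"
  obtains q where "q \<in> \<P>" "\<And>x. x \<in> carrier E \<Longrightarrow> family_norm M \<Q> x = q x"
proof -
  let ?A = "\<lambda>n::nat. if n = 0 then space M else {}"
  have "range ?A \<subseteq> sets M" "disjoint_family ?A"
    by (auto simp: disjoint_family_on_def)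
  from cc_familyD[OF assms(1) this, of "\<lambda>_. \<Q>"] assms(2) obtain q where "q \<in> \<P>" and
    q: "\<And>n x. x \<in> carrier E \<Longrightarrow> AE w in M. w \<in> ?A n \<longrightarrow> L0_rep (q x) w = L0_rep (family_norm M \<Q> x) w"
    by blast
  have "family_norm M \<Q> x = q x" if x: "x \<in> carrier E" for x
    using q[OF x, of 0] AE_space
    by (intro L0_eqI[OF family_norm_closed[OF assms(2) x] seminorm_closed[OF \<open>q \<in> \<P>\<close> x]]) auto
  then show thesis
    using that \<open>q \<in> \<P>\<close> by blast
qed

section \<open>The topology and its seminorm balls\<close>

lemma seminorms_nonempty: "\<P> \<noteq> {}"
proof
  assume "\<P> = {}"
  then have "L0_is_Sup M {} \<zero>\<^bsub>L0 M\<^esub>"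
    using separating[OF M.zero_closed] by simp
  \<comment> \<open>Every class is an upper bound of the empty family, so its supremum would lie
    below -1.\<close>
  then have "L0_le M \<zero>\<^bsub>L0 M\<^esub> (L0_class M (\<lambda>_. - 1))"
    by (simp add: L0_is_Sup_def L0_class_closed)
  then have "AE w in M. (0::real) \<le> - 1"
    unfolding L0_le_def L0_simps using L0_rep_class(2)[of "\<lambda>_. 0 :: real" M, OF borel_measurable_const]
      L0_rep_class(2)[of "\<lambda>_. - 1 :: real" M, OF borel_measurable_const]
    by eventually_elim simp
  then show False
    by (simp add: AE_False emeasure_space_1)
qed

text \<open>Openness of the carrier asks for one basic neighbourhood at each point, hence for a
  nonempty \<open>\<P>\<close>.\<close>

lemma topspace_Tc: "topspace (Tc M E \<P>) = carrier E"
proof -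
  obtain p where "{p} \<in> finite_subfamilies \<P>"
    using seminorms_nonempty by (auto simp: finite_subfamilies_def)
  moreover have "L0_class M (\<lambda>_. 1) \<in> L0_pos M"
    unfolding L0_pos_def using L0_rep_class(2)[of "\<lambda>_. 1 :: real" M] by (auto simp: L0_class_closed)
  ultimately have "Tc_open M E \<P> (carrier E)"
    unfolding Tc_open_def basic_nhd_def a_l_coset_def' by blast
  then show ?thesis
    unfolding topspace_def openin_Tc by (auto simp: Tc_open_def)
qed

text \<open>The radius is a function rather than a class, so that it can be required to be positive
  everywhere and be halved or glued pointwise.\<close>

definition seminorm_ball :: "('e \<Rightarrow> ('w \<Rightarrow> real) set) \<Rightarrow> ('w \<Rightarrow> real) \<Rightarrow> 'e set" where
  "seminorm_ball p \<epsilon> = {z \<in> carrier E. AE w in M. L0_rep (p z) w \<le> \<epsilon> w}"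

lemma seminorm_ball_convex:
  assumes p: "p \<in> \<P>"
  shows "L0_convex M E (seminorm_ball p \<epsilon>)"
  unfolding L0_convex_def
proof (intro ballI impI)
  fix x y \<xi>
  assume x: "x \<in> seminorm_ball p \<epsilon>" and y: "y \<in> seminorm_ball p \<epsilon>"
    and \<xi>: "\<xi> \<in> L0_nonneg M" and le: "L0_le M \<xi> \<one>\<^bsub>L0 M\<^esub>"
  interpret R0: cring "L0 M :: ('w \<Rightarrow> real) set ring"
    by (rule cring_L0)
  have cx: "x \<in> carrier E" and cy: "y \<in> carrier E"
    using x y by (auto simp: seminorm_ball_def)
  have c\<xi>: "\<xi> \<in> carrier (L0 M)"
    using \<xi> by (simp add: L0_nonneg_def)
  have c1: "\<one>\<^bsub>L0 M\<^esub> \<ominus>\<^bsub>L0 M\<^esub> \<xi> \<in> carrier (L0 M)"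
    using c\<xi> by simp
  let ?a = "L0_of_real M \<xi> :: ('w \<Rightarrow> 'k) set"
  let ?b = "L0_of_real M (\<one>\<^bsub>L0 M\<^esub> \<ominus>\<^bsub>L0 M\<^esub> \<xi>) :: ('w \<Rightarrow> 'k) set"
  note ca = L0_rep_of_real(2)[OF c\<xi>, where 'k = 'k] and cb = L0_rep_of_real(2)[OF c1, where 'k = 'k]
  have zero: "AE w in M. L0_rep (\<zero>\<^bsub>L0 M\<^esub>) w = (0::real)"
    unfolding L0_simps by (rule L0_rep_class) simp
  have one: "AE w in M. L0_rep (\<one>\<^bsub>L0 M\<^esub>) w = (1::real)"
    unfolding L0_simps by (rule L0_rep_class) simp
  have nonneg: "AE w in M. L0_rep (\<zero>\<^bsub>L0 M\<^esub>) w \<le> L0_rep \<xi> w"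
    using \<xi> by (simp add: L0_nonneg_def L0_le_def)
  have px: "AE w in M. L0_rep (p x) w \<le> \<epsilon> w" and py: "AE w in M. L0_rep (p y) w \<le> \<epsilon> w"
    using x y by (auto simp: seminorm_ball_def)
  have "AE w in M. L0_rep (p (?a \<odot>\<^bsub>E\<^esub> x \<oplus>\<^bsub>E\<^esub> ?b \<odot>\<^bsub>E\<^esub> y)) w \<le> \<epsilon> w"
    using seminorm_add[OF p smult_closed[OF ca cx] smult_closed[OF cb cy]]
      seminorm_smult[OF p cx ca] seminorm_smult[OF p cy cb]
      L0_rep_of_real(1)[OF c\<xi>, where 'k = 'k] L0_rep_of_real(1)[OF c1, where 'k = 'k]
      L0_rep_one_minus[OF c\<xi>] zero one nonneg le[unfolded L0_le_def] px py
  proof eventually_elim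
    case (elim w)
    define t where "t = L0_rep \<xi> w"
    have t: "0 \<le> t" "t \<le> 1"
      using elim(7-10) by (simp_all add: t_def)
    \<comment> \<open>The difference has to stay inside \<open>of_real\<close> for
      \<open>norm_of_real\<close> to apply.\<close>
    have n: "norm (L0_rep ?a w) = t" "norm (L0_rep ?b w) = 1 - t"
      unfolding elim(4-6) using t by (simp_all add: t_def norm_of_real del: of_real_diff)
    have "L0_rep (p (?a \<odot>\<^bsub>E\<^esub> x \<oplus>\<^bsub>E\<^esub> ?b \<odot>\<^bsub>E\<^esub> y)) w
        \<le> t * L0_rep (p x) w + (1 - t) * L0_rep (p y) w"
      using elim(1-3) n by simp
    also have "\<dots> \<le> t * \<epsilon> w + (1 - t) * \<epsilon> w"
      using t elim(11,12) by (intro add_mono mult_left_mono) auto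
    finally show ?case
      by (simp add: algebra_simps)
  qed
  then show "?a \<odot>\<^bsub>E\<^esub> x \<oplus>\<^bsub>E\<^esub> ?b \<odot>\<^bsub>E\<^esub> y \<in> seminorm_ball p \<epsilon>"
    using smult_closed[OF ca cx] smult_closed[OF cb cy] by (simp add: seminorm_ball_def)
qed

lemma seminorm_ball_balanced:
  assumes p: "p \<in> \<P>"
  shows "L0_balanced M E (seminorm_ball p \<epsilon>)"
  unfolding L0_balanced_def
proof (intro ballI impI image_subsetI)
  fix \<eta> :: "('w \<Rightarrow> 'k) set" and x
  assume \<eta>: "\<eta> \<in> carrier (L0 M)" and le: "L0_le M (L0_abs M \<eta>) \<one>\<^bsub>L0 M\<^esub>" and x: "x \<in> seminorm_ball p \<epsilon>"
  have cx: "x \<in> carrier E" and px: "AE w in M. L0_rep (p x) w \<le> \<epsilon> w"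
    using x by (auto simp: seminorm_ball_def)
  have one: "AE w in M. L0_rep (\<one>\<^bsub>L0 M\<^esub>) w = (1::real)"
    unfolding L0_simps by (rule L0_rep_class) simp
  have "AE w in M. L0_rep (p (\<eta> \<odot>\<^bsub>E\<^esub> x)) w \<le> \<epsilon> w"
    using seminorm_smult[OF p cx \<eta>] seminorm_nonneg[OF p cx] L0_rep_abs(1)[OF \<eta>] one
      le[unfolded L0_le_def] px
  proof eventually_elim
    case (elim w)
    have "norm (L0_rep \<eta> w) * L0_rep (p x) w \<le> 1 * L0_rep (p x) w"
      using elim by (intro mult_right_mono) auto
    then show ?case
      using elim by simp
  qed
  then show "\<eta> \<odot>\<^bsub>E\<^esub> x \<in> seminorm_ball p \<epsilon>"
    using \<eta> cx by (simp add: seminorm_ball_def)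
qed

lemma seminorm_ball_absorbent:
  assumes p: "p \<in> \<P>" and [measurable]: "\<epsilon> \<in> borel_measurable M" and pos: "\<And>w. 0 < \<epsilon> w"
  shows "L0_absorbent M E (seminorm_ball p \<epsilon>)"
  unfolding L0_absorbent_def
proof
  fix x assume x: "x \<in> carrier E"
  note [measurable] = seminorm_measurable[OF p x]
  \<comment> \<open>The summand 1 avoids division by zero where \<open>p x\<close> vanishes; the
    absolute value keeps the denominator positive at every point, since the representative of
    \<open>p x\<close> is nonnegative only almost surely.\<close>
  define f where "f w = \<epsilon> w / (1 + \<bar>L0_rep (p x) w\<bar>)" for w
  have [measurable]: "f \<in> borel_measurable M"
    unfolding f_def by measurable
  have f_pos: "0 < f w" for w
    unfolding f_def using pos by (intro divide_pos_pos) (auto intro: add_pos_nonneg)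
  have rep: "AE w in M. L0_rep (L0_class M f) w = f w"
    by (rule L0_rep_class) measurable
  then have "L0_class M f \<in> L0_pos M"
    using f_pos by (auto simp: L0_pos_def L0_class_closed)
  moreover have "\<eta> \<odot>\<^bsub>E\<^esub> x \<in> seminorm_ball p \<epsilon>"
    if \<eta>: "\<eta> \<in> carrier (L0 M)" and le: "L0_le M (L0_abs M \<eta>) (L0_class M f)" for \<eta> :: "('w \<Rightarrow> 'k) set"
  proof -
    have "AE w in M. L0_rep (p (\<eta> \<odot>\<^bsub>E\<^esub> x)) w \<le> \<epsilon> w"
      using seminorm_smult[OF p x \<eta>] seminorm_nonneg[OF p x] L0_rep_abs(1)[OF \<eta>] rep
        le[unfolded L0_le_def]
    proof eventually_elim
      case (elim w)
      have "norm (L0_rep \<eta> w) * L0_rep (p x) w \<le> f w * (1 + \<bar>L0_rep (p x) w\<bar>)"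
        using elim f_pos[of w] by (intro mult_mono) auto
      also have "\<dots> = \<epsilon> w"
        unfolding f_def by (simp add: add_nonneg_eq_0_iff)
      finally show ?case
        using elim by simp
    qed
    then show ?thesis
      using \<eta> x by (simp add: seminorm_ball_def)
  qed
  ultimately show "\<exists>\<xi>\<in>L0_pos M. \<forall>\<eta>\<in>carrier (L0 M).
      L0_le M (L0_abs M \<eta>) \<xi> \<longrightarrow> \<eta> \<odot>\<^bsub>E\<^esub> x \<in> seminorm_ball p \<epsilon>"
    by blast
qed

text \<open>The strict ball \<open>G\<close> is an open set between the null vector and the ball: at
  each of its points the gap to the radius is positive almost surely, which leaves room for a basic
  neighbourhood.\<close>

lemma seminorm_ball_nhd:
  assumes p: "p \<in> \<P>" and [measurable]: "\<epsilon> \<in> borel_measurable M" and pos: "\<And>w. 0 < \<epsilon> w"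
  shows "nhd_in (Tc M E \<P>) \<zero>\<^bsub>E\<^esub> (seminorm_ball p \<epsilon>)"
proof -
  define G where "G = {z \<in> carrier E. AE w in M. L0_rep (p z) w < \<epsilon> w}"
  have "Tc_open M E \<P> G"
    unfolding Tc_open_def
  proof (intro conjI ballI)
    show "G \<subseteq> carrier E"
      by (auto simp: G_def)
    fix z assume "z \<in> G"
    then have z: "z \<in> carrier E" and pz: "AE w in M. L0_rep (p z) w < \<epsilon> w"
      by (auto simp: G_def)
    note [measurable] = seminorm_measurable[OF p z]
    \<comment> \<open>Basic neighbourhoods are nonstrict, so only half of the gap is used:
      \<open>p z\<close> plus half the gap is still strictly below \<epsilon>.\<close>
    define \<delta> where "\<delta> = L0_class M (\<lambda>w. (\<epsilon> w - L0_rep (p z) w) / 2)"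
    have rep: "AE w in M. L0_rep \<delta> w = (\<epsilon> w - L0_rep (p z) w) / 2"
      unfolding \<delta>_def by (rule L0_rep_class) measurable
    with pz have "AE w in M. 0 < L0_rep \<delta> w"
      by eventually_elim simp
    then have \<delta>: "\<delta> \<in> L0_pos M"
      unfolding L0_pos_def \<delta>_def by (simp add: L0_class_closed)
    have "z \<oplus>\<^bsub>E\<^esub> b \<in> G" if "b \<in> basic_nhd M E {p} \<delta>" for b
    proof -
      have b: "b \<in> carrier E" and pb: "AE w in M. L0_rep (p b) w \<le> L0_rep \<delta> w"
        using that p by (auto simp: basic_nhd_def family_norm_singleton L0_le_def)
      have "AE w in M. L0_rep (p (z \<oplus>\<^bsub>E\<^esub> b)) w < \<epsilon> w"
        using seminorm_add[OF p z b] pb rep pz by eventually_elim (simp add: field_simps)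
      then show ?thesis
        using z b by (simp add: G_def)
    qed
    then have "z <+\<^bsub>E\<^esub> basic_nhd M E {p} \<delta> \<subseteq> G"
      by (auto simp: a_l_coset_def')
    moreover have "{p} \<in> finite_subfamilies \<P>"
      using p by (simp add: finite_subfamilies_def)
    ultimately show "\<exists>\<Q>\<in>finite_subfamilies \<P>. \<exists>\<epsilon>\<in>L0_pos M. z <+\<^bsub>E\<^esub> basic_nhd M E \<Q> \<epsilon> \<subseteq> G"
      using \<delta> by blast
  qed
  moreover have "\<zero>\<^bsub>E\<^esub> \<in> G"
    using seminorm_zero[OF p] pos by (auto simp: G_def)
  moreover have "G \<subseteq> seminorm_ball p \<epsilon>"
    by (auto simp: G_def seminorm_ball_def elim: eventually_mono)
  ultimately show ?thesis
    unfolding nhd_in_def openin_Tc topspace_Tc by (auto simp: seminorm_ball_def)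
qed

text \<open>If \<open>x + u\<close> and \<open>y + v\<close> agree on \<open>A\<close>, subtracting
  \<open>x + v\<close> shows that \<open>u - v\<close> and \<open>y - x\<close> agree there. On
  \<open>A\<close> this gives \<epsilon> < p (y - x) = p (u - v) \<le> \<epsilon>/2 + \<epsilon>/2
  almost surely, so \<open>A\<close> is null.\<close>

lemma seminorm_ball_separates:
  assumes p: "p \<in> \<P>" and x: "x \<in> carrier E" and S: "S \<subseteq> carrier E"
    and pos: "\<And>w. 0 < \<epsilon> w"
    and far: "\<And>y. y \<in> S \<Longrightarrow> AE w in M. \<epsilon> w < L0_rep (p (y \<ominus>\<^bsub>E\<^esub> x)) w"
    and A: "A \<in> sets M" "0 < measure M A"
  defines "U \<equiv> seminorm_ball p (\<lambda>w. \<epsilon> w / 2)"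
  shows "ind_image M E A (x <+\<^bsub>E\<^esub> U) \<inter> ind_image M E A (S <+>\<^bsub>E\<^esub> U) = {}"
proof (rule ccontr)
  assume "ind_image M E A (x <+\<^bsub>E\<^esub> U) \<inter> ind_image M E A (S <+>\<^bsub>E\<^esub> U) \<noteq> {}"
  then obtain u v y where uv: "u \<in> U" "v \<in> U" and "y \<in> S"
    and eq: "L0_indicator M A \<odot>\<^bsub>E\<^esub> (x \<oplus>\<^bsub>E\<^esub> u) = L0_indicator M A \<odot>\<^bsub>E\<^esub> (y \<oplus>\<^bsub>E\<^esub> v)"
    by (auto simp: ind_image_def a_l_coset_def' set_add_def')
  have u: "u \<in> carrier E" "AE w in M. L0_rep (p u) w \<le> \<epsilon> w / 2"
    and v: "v \<in> carrier E" "AE w in M. L0_rep (p v) w \<le> \<epsilon> w / 2"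
    using uv by (auto simp: U_def seminorm_ball_def)
  have y: "y \<in> carrier E"
    using \<open>y \<in> S\<close> S by blast
  have "(x \<oplus>\<^bsub>E\<^esub> u) \<ominus>\<^bsub>E\<^esub> (x \<oplus>\<^bsub>E\<^esub> v) = u \<ominus>\<^bsub>E\<^esub> v" "(y \<oplus>\<^bsub>E\<^esub> v) \<ominus>\<^bsub>E\<^esub> (x \<oplus>\<^bsub>E\<^esub> v) = y \<ominus>\<^bsub>E\<^esub> x"
    using minus_add_cancel_left[OF u(1) v(1) x] minus_add_cancel_left[OF y x v(1)] x y v(1)
    by (simp_all add: M.a_comm)
  with indicator_smult_minus[OF _ _ _ A(1) eq, of "x \<oplus>\<^bsub>E\<^esub> v"] x y u(1) v(1)
  have "L0_indicator M A \<odot>\<^bsub>E\<^esub> (u \<ominus>\<^bsub>E\<^esub> v) = L0_indicator M A \<odot>\<^bsub>E\<^esub> (y \<ominus>\<^bsub>E\<^esub> x)"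
    by simp
  then have "AE w in M. w \<in> A \<longrightarrow> L0_rep (p (u \<ominus>\<^bsub>E\<^esub> v)) w = L0_rep (p (y \<ominus>\<^bsub>E\<^esub> x)) w"
    using x y u(1) v(1) by (intro seminorm_eq_on[OF p _ _ A(1)]) auto
  moreover have "AE w in M. L0_rep (p (u \<ominus>\<^bsub>E\<^esub> v)) w \<le> L0_rep (p u) w + L0_rep (p v) w"
    using seminorm_add[OF p u(1) M.a_inv_closed[OF v(1)]] seminorm_uminus[OF p v(1)]
    unfolding a_minus_def by eventually_elim simp
  ultimately have "AE w in M. w \<notin> A"
    using far[OF \<open>y \<in> S\<close>] u(2) v(2) by eventually_elim auto
  then have "measure M A = 0"
    using A(1) by (simp add: measure_eq_0_null_sets AE_iff_null_sets)
  with A(2) show False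
    by simp
qed

section \<open>A uniform distance between the point and the closed set\<close>

lemma locally_uniform_distance:
  assumes cc: "cc_family M E \<P>" and closed: "closedin (Tc M E \<P>) S" and ccS: "cc_set M E S"
    and x: "x \<in> carrier E" and ne: "S \<noteq> {}"
    and disj: "\<And>A. A \<in> sets M \<Longrightarrow> 0 < measure M A \<Longrightarrow> ind_image M E A {x} \<inter> ind_image M E A S = {}"
  obtains p \<epsilon> where "p \<in> \<P>" "\<epsilon> \<in> borel_measurable M" "\<And>w. 0 < \<epsilon> w"
    "\<And>y. y \<in> S \<Longrightarrow> AE w in M. \<epsilon> w < L0_rep (p (y \<ominus>\<^bsub>E\<^esub> x)) w"
proof -
  have S: "S \<subseteq> carrier E"
    using closedin_subset[OF closed] by (simp add: topspace_Tc)
  have yx: "y \<ominus>\<^bsub>E\<^esub> x \<in> carrier E" if "y \<in> S" for y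
    using that S x by auto
  obtain y0 where y0: "y0 \<in> S" "y0 \<in> carrier E"
    using ne S by blast
  \<comment> \<open>These are the good sets. One pair \<open>p\<close>, \<open>\<epsilon>\<close>
    has to serve all \<open>y\<close> in \<open>S\<close>, while the null set may depend on
    \<open>y\<close>.\<close>
  define \<Phi> where "\<Phi> A \<longleftrightarrow> A \<in> sets M \<and> (\<exists>p\<in>\<P>. \<exists>\<epsilon>\<in>borel_measurable M. (\<forall>w. 0 < \<epsilon> w) \<and>
    (\<forall>y\<in>S. AE w in M. w \<in> A \<longrightarrow> \<epsilon> w < L0_rep (p (y \<ominus>\<^bsub>E\<^esub> x)) w))" for A
  obtain p0 where p0: "p0 \<in> \<P>"
    using seminorms_nonempty by blast
  obtain H where H: "\<Phi> H" and max: "\<And>A. \<Phi> A \<Longrightarrow> A \<inter> H = {} \<Longrightarrow> measure M A = 0"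
  proof (rule exhaustion[of \<Phi>])
    show "A \<in> sets M" if "\<Phi> A" for A
      using that by (simp add: \<Phi>_def)
    show "\<Phi> B" if A: "\<Phi> A" and B: "B \<in> sets M" "B \<subseteq> A" for A B
    proof -
      obtain p \<epsilon> where "p \<in> \<P>" "\<epsilon> \<in> borel_measurable M" "\<forall>w. 0 < \<epsilon> w"
        and far: "\<forall>y\<in>S. AE w in M. w \<in> A \<longrightarrow> \<epsilon> w < L0_rep (p (y \<ominus>\<^bsub>E\<^esub> x)) w"
        using A unfolding \<Phi>_def by blast
      moreover have "AE w in M. w \<in> B \<longrightarrow> \<epsilon> w < L0_rep (p (y \<ominus>\<^bsub>E\<^esub> x)) w" if "y \<in> S" for y
        using far[rule_format, OF that] by eventually_elim (use B(2) in blast)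
      ultimately show ?thesis
        unfolding \<Phi>_def using B(1) by blast
    qed
    show "\<Phi> {}"
      unfolding \<Phi>_def by (intro conjI bexI[OF _ p0] bexI[of _ "\<lambda>_. 1 :: real"]) auto
    fix A :: "nat \<Rightarrow> 'w set" assume A: "\<And>n. \<Phi> (A n)" and dA: "disjoint_family A"
    have [measurable]: "A n \<in> sets M" for n
      using A by (simp add: \<Phi>_def)
    define R where "R n p \<epsilon> \<longleftrightarrow> p \<in> \<P> \<and> \<epsilon> \<in> borel_measurable M \<and> (\<forall>w. 0 < \<epsilon> w) \<and>
        (\<forall>y\<in>S. AE w in M. w \<in> A n \<longrightarrow> \<epsilon> w < L0_rep (p (y \<ominus>\<^bsub>E\<^esub> x)) w)" for n p \<epsilon>
    have "\<exists>p \<epsilon>. R n p \<epsilon>" for n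
      using A[of n] unfolding \<Phi>_def R_def by blast
    then obtain p \<epsilon> where R: "\<And>n. R n (p n) (\<epsilon> n)"
      by metis
    have p: "p n \<in> \<P>" and [measurable]: "\<epsilon> n \<in> borel_measurable M" and pos: "0 < \<epsilon> n w"
      and far: "y \<in> S \<Longrightarrow> AE w in M. w \<in> A n \<longrightarrow> \<epsilon> n w < L0_rep (p n (y \<ominus>\<^bsub>E\<^esub> x)) w" for n w y
      using R[of n] by (simp_all add: R_def)
    have A_sets: "range A \<subseteq> sets M"
      by auto
    have "{p n} \<in> finite_subfamilies \<P>" for n
      using p by (simp add: finite_subfamilies_def)
    \<comment> \<open>Here \<open>\<P>\<close> is used as a concatenation-closed family: a single
      \<open>q\<close> acts as \<open>p n\<close> on each \<open>A n\<close>.\<close>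
    then obtain q where q: "q \<in> \<P>" "\<And>n z. z \<in> carrier E \<Longrightarrow>
        AE w in M. w \<in> A n \<longrightarrow> L0_rep (q z) w = L0_rep (family_norm M {p n} z) w"
      using cc_familyD[OF cc A_sets dA, of "\<lambda>n. {p n}"] by blast
    \<comment> \<open>The radii are glued in the same way; the default 1 off the union keeps
      \<open>e\<close> positive everywhere.\<close>
    define e where "e w = (if w \<in> (\<Union>n. A n) then \<Sum>n. indicator (A n) w * \<epsilon> n w else 1)" for w
    have e: "e w = \<epsilon> n w" if "w \<in> A n" for n w
      using that suminf_indicator_disjoint[OF dA that, of "\<lambda>n. \<epsilon> n w"] by (auto simp: e_def)
    have e_pos: "0 < e w" for w
    proof (cases "w \<in> (\<Union>n. A n)")
      case True
      then show ?thesis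
        using e pos by fastforce
    qed (auto simp: e_def)
    have "AE w in M. w \<in> (\<Union>n. A n) \<longrightarrow> e w < L0_rep (q (y \<ominus>\<^bsub>E\<^esub> x)) w" if y: "y \<in> S" for y
    proof -
      have "AE w in M. w \<in> A n \<longrightarrow> e w < L0_rep (q (y \<ominus>\<^bsub>E\<^esub> x)) w" for n
        using q(2)[OF yx[OF y], of n] far[OF y, of n]
        by eventually_elim (simp add: e family_norm_singleton[OF p yx[OF y]])
      then have "AE w in M. \<forall>n. w \<in> A n \<longrightarrow> e w < L0_rep (q (y \<ominus>\<^bsub>E\<^esub> x)) w"
        unfolding AE_all_countable by (rule allI)
      then show ?thesis
        by eventually_elim auto
    qed
    moreover have "e \<in> borel_measurable M"
      unfolding e_def by measurable
    ultimately show "\<Phi> (\<Union>n. A n)"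
      unfolding \<Phi>_def using e_pos by (intro conjI bexI[OF _ q(1)] bexI[of _ e]) auto
  qed blast
  have H_sets [measurable]: "H \<in> sets M"
    using H by (simp add: \<Phi>_def)
  define D where "D = space M - H"
  have D_sets [measurable]: "D \<in> sets M"
    by (simp add: D_def)
  have DH: "D \<inter> H = {}" "H \<inter> D = {}"
    by (auto simp: D_def)
  have "measure M D = 0"
  proof (rule ccontr)
    assume "measure M D \<noteq> 0"
    then have D_pos: "0 < measure M D"
      using measure_nonneg[of M D] by linarith
    \<comment> \<open>Using \<open>y0\<close> on \<open>H\<close> leaves only \<open>D\<close> to
      approximate. Still \<open>x'\<close> is outside \<open>S\<close>, since it agrees with
      \<open>x\<close> on \<open>D\<close>, where disjointness is assumed.\<close>
    define x' where "x' = L0_indicator M D \<odot>\<^bsub>E\<^esub> x \<oplus>\<^bsub>E\<^esub> L0_indicator M H \<odot>\<^bsub>E\<^esub> y0"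
    note ID = L0_rep_indicator(2)[OF D_sets, where 'k = 'k] and IH = L0_rep_indicator(2)[OF H_sets, where 'k = 'k]
    have x': "x' \<in> carrier E"
      unfolding x'_def using x y0 ID IH by simp
    have x'_D: "L0_indicator M D \<odot>\<^bsub>E\<^esub> x' = L0_indicator M D \<odot>\<^bsub>E\<^esub> x"
      unfolding x'_def by (intro indicator_smult_glue x y0 D_sets H_sets DH)
    have x'_H: "L0_indicator M H \<odot>\<^bsub>E\<^esub> x' = L0_indicator M H \<odot>\<^bsub>E\<^esub> y0"
      unfolding x'_def using indicator_smult_glue[OF y0(2) x H_sets D_sets DH(2)] x y0 ID IH
      by (simp add: M.a_comm)
    have "x' \<notin> S"
      using disj[OF D_sets D_pos] x'_D[symmetric] unfolding ind_image_def by blast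
    moreover have "Tc_open M E \<P> (carrier E - S)"
      using closed by (simp add: closedin_def topspace_Tc openin_Tc)
    ultimately obtain \<Q> \<delta> where Q: "\<Q> \<in> finite_subfamilies \<P>" and \<delta>: "\<delta> \<in> L0_pos M"
      and sub: "x' <+\<^bsub>E\<^esub> basic_nhd M E \<Q> \<delta> \<subseteq> carrier E - S"
      unfolding Tc_open_def using x' by blast
    obtain p where p: "p \<in> \<P>" and pQ: "\<And>z. z \<in> carrier E \<Longrightarrow> family_norm M \<Q> z = p z"
      using family_norm_in_cc[OF cc Q] by blast
    \<comment> \<open>A representative of \<delta> is positive only almost surely; the correction
      makes \<epsilon> admissible as a witness in \<Phi>.\<close>
    define \<epsilon> where "\<epsilon> w = (if 0 < L0_rep \<delta> w then L0_rep \<delta> w else 1)" for w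
    have [measurable]: "L0_rep \<delta> \<in> borel_measurable M"
      using \<delta> by (auto simp: L0_pos_def intro: L0_rep_measurable)
    have \<epsilon>_meas [measurable]: "\<epsilon> \<in> borel_measurable M"
      unfolding \<epsilon>_def by measurable
    have \<epsilon>_pos: "0 < \<epsilon> w" for w
      by (simp add: \<epsilon>_def)
    have \<epsilon>\<delta>: "AE w in M. \<epsilon> w = L0_rep \<delta> w"
      using \<delta> unfolding L0_pos_def \<epsilon>_def by auto
    \<comment> \<open>For the second exhaustion \<open>p\<close> and \<epsilon> are fixed, and one
      \<open>y\<close> has to be near \<open>x\<close> on the whole of \<open>A\<close>.\<close>
    define \<Psi> where "\<Psi> A \<longleftrightarrow> A \<in> sets M \<and> A \<subseteq> D \<and>
      (\<exists>y\<in>S. AE w in M. w \<in> A \<longrightarrow> L0_rep (p (y \<ominus>\<^bsub>E\<^esub> x)) w \<le> \<epsilon> w)" for A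
    obtain G where G: "\<Psi> G" and Gmax: "\<And>A. \<Psi> A \<Longrightarrow> A \<inter> G = {} \<Longrightarrow> measure M A = 0"
    proof (rule exhaustion[of \<Psi>])
      show "A \<in> sets M" if "\<Psi> A" for A
        using that by (simp add: \<Psi>_def)
      show "\<Psi> B" if A: "\<Psi> A" and B: "B \<in> sets M" "B \<subseteq> A" for A B
      proof -
        obtain y where y: "y \<in> S" and near: "AE w in M. w \<in> A \<longrightarrow> L0_rep (p (y \<ominus>\<^bsub>E\<^esub> x)) w \<le> \<epsilon> w"
          using A unfolding \<Psi>_def by blast
        have "AE w in M. w \<in> B \<longrightarrow> L0_rep (p (y \<ominus>\<^bsub>E\<^esub> x)) w \<le> \<epsilon> w"
          using near by eventually_elim (use B(2) in blast)
        then show ?thesis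
          using A B y unfolding \<Psi>_def by blast
      qed
      show "\<Psi> {}"
        using y0 by (auto simp: \<Psi>_def)
      fix A :: "nat \<Rightarrow> 'w set" assume A: "\<And>n. \<Psi> (A n)" and dA: "disjoint_family A"
      have A_sets [measurable]: "A n \<in> sets M" for n
        using A by (simp add: \<Psi>_def)
      obtain Y where Y: "\<And>n. Y n \<in> S"
        and near: "\<And>n. AE w in M. w \<in> A n \<longrightarrow> L0_rep (p (Y n \<ominus>\<^bsub>E\<^esub> x)) w \<le> \<epsilon> w"
        using A unfolding \<Psi>_def by metis
      \<comment> \<open>Now \<open>S\<close> is used as a concatenation-closed set: the points
        \<open>Y n\<close> are glued along the sets \<open>A n\<close>.\<close>
      obtain y where y: "y \<in> S"
        and eq: "\<And>n. L0_indicator M (A n) \<odot>\<^bsub>E\<^esub> y = L0_indicator M (A n) \<odot>\<^bsub>E\<^esub> Y n"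
        using cc_setD[OF ccS _ dA image_subsetI, of Y] A_sets Y by blast
      have "AE w in M. w \<in> A n \<longrightarrow> L0_rep (p (y \<ominus>\<^bsub>E\<^esub> x)) w \<le> \<epsilon> w" for n
        using seminorm_eq_on[OF p yx[OF y] yx[OF Y[of n]] A_sets
            indicator_smult_minus[OF _ _ x A_sets eq[of n]]] near[of n] y Y[of n] S
        by (auto simp: subset_iff)
      then have "AE w in M. \<forall>n. w \<in> A n \<longrightarrow> L0_rep (p (y \<ominus>\<^bsub>E\<^esub> x)) w \<le> \<epsilon> w"
        unfolding AE_all_countable by (rule allI)
      then have "AE w in M. w \<in> (\<Union>n. A n) \<longrightarrow> L0_rep (p (y \<ominus>\<^bsub>E\<^esub> x)) w \<le> \<epsilon> w"
        by eventually_elim auto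
      moreover have "(\<Union>n. A n) \<in> sets M" "(\<Union>n. A n) \<subseteq> D"
        using A unfolding \<Psi>_def by auto
      ultimately show "\<Psi> (\<Union>n. A n)"
        using y unfolding \<Psi>_def by blast
    qed blast
    have [measurable]: "G \<in> sets M"
      using G by (simp add: \<Psi>_def)
    \<comment> \<open>The part of \<open>D - G\<close> where \<open>y\<close> comes within
      \<epsilon> satisfies \<Psi> and misses \<open>G\<close>, so it is null.\<close>
    have "AE w in M. w \<in> D - G \<longrightarrow> \<epsilon> w < L0_rep (p (y \<ominus>\<^bsub>E\<^esub> x)) w" if y: "y \<in> S" for y
    proof -
      note [measurable] = seminorm_measurable[OF p yx[OF y]]
      define B where "B = {w \<in> space M. w \<in> D - G \<and> L0_rep (p (y \<ominus>\<^bsub>E\<^esub> x)) w \<le> \<epsilon> w}"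
      have B: "B \<in> sets M"
        unfolding B_def by measurable
      have "\<Psi> B"
        unfolding \<Psi>_def using B y by (auto simp: B_def)
      then have "measure M B = 0"
        by (rule Gmax) (auto simp: B_def)
      then have "AE w in M. w \<notin> B"
        using B by (intro AE_not_in null_setsI) (auto simp: emeasure_eq_measure)
      then show ?thesis
        using AE_space by eventually_elim (auto simp: B_def)
    qed
    \<comment> \<open>Thus \<open>D - G\<close> is good and misses \<open>H\<close>; maximality of
      \<open>H\<close> makes it null, and the point that is near on \<open>G\<close> is near on all
      of \<open>D\<close>.\<close>
    then have "\<Phi> (D - G)"
      unfolding \<Phi>_def by (intro conjI bexI[OF _ p] bexI[OF _ \<epsilon>_meas]) (simp_all add: \<epsilon>_pos)
    then have "measure M (D - G) = 0"
      by (rule max) (auto simp: D_def)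
    then have "AE w in M. w \<notin> D - G"
      by (intro AE_not_in null_setsI) (auto simp: emeasure_eq_measure)
    moreover obtain y where y: "y \<in> S"
      and near: "AE w in M. w \<in> G \<longrightarrow> L0_rep (p (y \<ominus>\<^bsub>E\<^esub> x)) w \<le> \<epsilon> w"
      using G unfolding \<Psi>_def by blast
    ultimately have near_D: "AE w in M. w \<in> D \<longrightarrow> L0_rep (p (y \<ominus>\<^bsub>E\<^esub> x)) w \<le> \<epsilon> w"
      by eventually_elim auto
    \<comment> \<open>The approximant \<open>z\<close> takes \<open>y\<close> on \<open>D\<close>
      and \<open>y0\<close> on \<open>H\<close>; the empty sets at later indices impose
      nothing.\<close>
    let ?A = "\<lambda>n::nat. if n = 0 then D else if n = 1 then H else {}"
    let ?Y = "\<lambda>n::nat. if n = 0 then y else y0"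
    have "range ?A \<subseteq> sets M" "disjoint_family ?A" "range ?Y \<subseteq> S"
      using DH y y0 by (auto simp: disjoint_family_on_def)
    from cc_setD[OF ccS this] obtain z where z: "z \<in> S"
      and eq: "\<And>n. L0_indicator M (?A n) \<odot>\<^bsub>E\<^esub> z = L0_indicator M (?A n) \<odot>\<^bsub>E\<^esub> ?Y n"
      by blast
    have yE: "y \<in> carrier E" and zE: "z \<in> carrier E"
      using y z S by auto
    have zx': "z \<ominus>\<^bsub>E\<^esub> x' \<in> carrier E"
      using zE x' by simp
    have "L0_indicator M D \<odot>\<^bsub>E\<^esub> (z \<ominus>\<^bsub>E\<^esub> x') = L0_indicator M D \<odot>\<^bsub>E\<^esub> (y \<ominus>\<^bsub>E\<^esub> x)"
      using eq[of 0] x'_D zE yE x x' ID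
      by (simp add: a_minus_def smult_r_distr smult_r_minus)
    from seminorm_eq_on[OF p zx' yx[OF y] D_sets this] near_D
    have "AE w in M. w \<in> D \<longrightarrow> L0_rep (p (z \<ominus>\<^bsub>E\<^esub> x')) w \<le> \<epsilon> w"
      by eventually_elim simp
    \<comment> \<open>Both \<open>z\<close> and \<open>x'\<close> equal \<open>y0\<close> on
      \<open>H\<close>, so their difference vanishes there.\<close>
    moreover have "L0_indicator M H \<odot>\<^bsub>E\<^esub> (z \<ominus>\<^bsub>E\<^esub> x') = L0_indicator M H \<odot>\<^bsub>E\<^esub> \<zero>\<^bsub>E\<^esub>"
      using eq[of 1] x'_H zE y0 x' IH
      by (simp add: a_minus_def smult_r_distr smult_r_minus M.r_neg)
    from seminorm_eq_on[OF p zx' M.zero_closed H_sets this] seminorm_zero[OF p]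
    have "AE w in M. w \<in> H \<longrightarrow> L0_rep (p (z \<ominus>\<^bsub>E\<^esub> x')) w \<le> \<epsilon> w"
      by eventually_elim (simp add: \<epsilon>_pos less_imp_le)
    ultimately have "AE w in M. L0_rep (p (z \<ominus>\<^bsub>E\<^esub> x')) w \<le> L0_rep \<delta> w"
      using \<epsilon>\<delta> AE_space by eventually_elim (auto simp: D_def)
    then have "z \<ominus>\<^bsub>E\<^esub> x' \<in> basic_nhd M E \<Q> \<delta>"
      using zx' by (simp add: basic_nhd_def pQ L0_le_def)
    \<comment> \<open>This places \<open>z\<close> in the neighbourhood of \<open>x'\<close> that
      avoids \<open>S\<close>, although \<open>z\<close> belongs to \<open>S\<close>.\<close>
    moreover have "x' \<oplus>\<^bsub>E\<^esub> (z \<ominus>\<^bsub>E\<^esub> x') = z"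
      using M.a_lcomm[OF x' zE M.a_inv_closed[OF x']] x' zE by (simp add: a_minus_def M.r_neg)
    ultimately have "z \<in> carrier E - S"
      using sub unfolding a_l_coset_def' by force
    with z show False
      by simp
  qed
  then have AE_H: "AE w in M. w \<in> H"
    by (subst AE_iff_measurable[of D]) (auto simp: D_def emeasure_eq_measure)
  obtain p \<epsilon> where "p \<in> \<P>" "\<epsilon> \<in> borel_measurable M" "\<forall>w. 0 < \<epsilon> w"
    and far: "\<forall>y\<in>S. AE w in M. w \<in> H \<longrightarrow> \<epsilon> w < L0_rep (p (y \<ominus>\<^bsub>E\<^esub> x)) w"
    using H unfolding \<Phi>_def by blast
  moreover have "AE w in M. \<epsilon> w < L0_rep (p (y \<ominus>\<^bsub>E\<^esub> x)) w" if "y \<in> S" for y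
    using far[rule_format, OF that] AE_H by eventually_elim simp
  ultimately show thesis
    using that by blast
qed

end

section \<open>The separating neighbourhood\<close>

theorem theorem4p10:
  fixes Pr :: "'w measure"
    and E :: "(('w \<Rightarrow> 'k::{real_normed_field, euclidean_space}) set, 'e, 'z) module_scheme"
    and \<P> :: "('e \<Rightarrow> ('w \<Rightarrow> real) set) set"
    and M :: "'e set"
    and x :: 'e
  assumes "random_lc_module Pr E \<P>"
    and "cc_family Pr E \<P>"
    and "closedin (Tc Pr E \<P>) M"
    and "cc_set Pr E M"
    and "x \<in> carrier E"
    and "\<And>A. A \<in> sets Pr \<Longrightarrow> measure Pr A > 0 \<Longrightarrow>
           ind_image Pr E A {x} \<inter> ind_image Pr E A M = {}"
  shows "\<exists>U. L0_convex Pr E U \<and> L0_absorbent Pr E U \<and> L0_balanced Pr E U \<and>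
           nhd_in (Tc Pr E \<P>) \<zero>\<^bsub>E\<^esub> U \<and>
           (\<forall>A\<in>sets Pr. measure Pr A > 0 \<longrightarrow>
              ind_image Pr E A (x <+\<^bsub>E\<^esub> U) \<inter> ind_image Pr E A (M <+>\<^bsub>E\<^esub> U) = {})"
proof -
  interpret random_lc_module Pr E \<P>
    by (rule assms(1))
  have M: "M \<subseteq> carrier E"
    using closedin_subset[OF assms(3)] by (simp add: topspace_Tc)
  obtain p \<epsilon> where p: "p \<in> \<P>" and [measurable]: "\<epsilon> \<in> borel_measurable Pr" and pos: "\<And>w. 0 < \<epsilon> w"
    and far: "\<And>y. y \<in> M \<Longrightarrow> AE w in Pr. \<epsilon> w < L0_rep (p (y \<ominus>\<^bsub>E\<^esub> x)) w"
  proof (cases "M = {}")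
    case True
    \<comment> \<open>For empty \<open>M\<close> the distance condition is vacuous, so any seminorm
      with the constant radius 1 will do.\<close>
    obtain p where "p \<in> \<P>"
      using seminorms_nonempty by blast
    then show thesis
      using True that[of p "\<lambda>_. 1"] by simp
  next
    case False
    then show thesis
      using locally_uniform_distance[OF assms(2-5) False assms(6)] that by blast
  qed
  let ?U = "seminorm_ball p (\<lambda>w. \<epsilon> w / 2)"
  have \<epsilon>2: "(\<lambda>w. \<epsilon> w / 2) \<in> borel_measurable Pr" "\<And>w. 0 < \<epsilon> w / 2"
    using pos by simp_all
  show ?thesis
  proof (intro exI[of _ ?U] conjI ballI impI)
    show "L0_convex Pr E ?U" "L0_balanced Pr E ?U"
      by (rule seminorm_ball_convex[OF p] seminorm_ball_balanced[OF p])+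
    show "L0_absorbent Pr E ?U" "nhd_in (Tc Pr E \<P>) \<zero>\<^bsub>E\<^esub> ?U"
      by (rule seminorm_ball_absorbent[OF p \<epsilon>2] seminorm_ball_nhd[OF p \<epsilon>2])+
    show "ind_image Pr E A (x <+\<^bsub>E\<^esub> ?U) \<inter> ind_image Pr E A (M <+>\<^bsub>E\<^esub> ?U) = {}"
      if "A \<in> sets Pr" "0 < measure Pr A" for A
      by (rule seminorm_ball_separates[OF p assms(5) M pos far that])
  qed
qed

end
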